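(* If, for some $\epsilon$, there exists a polynomial time $\epsilon$-optimal algorithm for the weighted set cover problem, then there exists a polynomial time $\epsilon$-optimal algorithm for the minimum cost accessibility problem. Thus, in polynomial time, one can find a $\log\mu_{\max}$-optimal solution to the minimum cost accessibility problem for $(\bar A,\bar B,p_u)$, where $\mu_{\max}$ is the maximum number of non-top linked SCCs of $\mathcal{D}(\bar A)$ covered by a single input.
   Context: **Weighted set cover problem.** Given a universe $\mathcal{U}=\{1,\dots,N\}$, sets $\mathcal{S}_1,\dots,\mathcal{S}_r\subseteq\mathcal{U}$ with $\bigcup_i\mathcal{S}_i=\mathcal{U}$ and nonnegative real weights $w(1),\dots,w(r)$, find a subcollection whose union is $\mathcal{U}$ with minimum total weight. **Structural setting.** $\bar A\in\{\star,0\}^{n\times n}$, $\bar B\in\{\star,0\}^{n\times m}$, $\bar C\in\{\star,0\}^{p\times n}$, $\bar K\in\{\star,0\}^{m\times p}$, and $p_u\in\mathbb{R}_{\ge0}^m$ is the input cost vector. $\mathcal{D}(\bar A)$ is the digraph on $x_1,\dots,x_n$ with an edge $(x_j,x_i)$ iff $\bar A_{ij}=\star$. The system digraph $\mathcal{D}(\bar A,\bar B,\bar C,\bar K)$ has vertices $x_1,\dots,x_n,u_1,\dots,u_m,y_1,\dots,y_p$, the edges of $\mathcal{D}(\bar A)$, and edges $(u_j,x_i)$ iff $\bar B_{ij}=\star$, $(x_j,y_i)$ iff $\bar C_{ij}=\star$, $(y_j,u_i)$ iff $\bar K_{ij}=\star$. A state $x_i$ is accessible if there is a directed simple path from some input vertex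 $u_j$ to $x_i$ in this digraph. For $\mathcal{I}\subseteq\{1,\dots,m\}$, $\bar B_{\mathcal{I}}$ is the restriction of $\bar B$ to columns in $\mathcal{I}$, and $\mathcal{D}(\bar A,\bar B_{\mathcal{I}},\bar C,\bar K)$ is the system digraph using only the inputs in $\mathcal{I}$. **Minimum cost accessibility problem.** Given $(\bar A,\bar B,p_u)$, find $\mathcal{I}\subseteq\{1,\dots,m\}$ minimizing $p(\mathcal{I})=\sum_{i\in\mathcal{I}}p_u(i)$ subject to all states being accessible in $\mathcal{D}(\bar A,\bar B_{\mathcal{I}},\bar C,\bar K)$. It is assumed that $\mathcal{I}=\{1,\dots,m\}$ is feasible. A strongly connected component (SCC) of $\mathcal{D}(\bar A)$ is non-top linked if it has no incoming edge from another SCC; it is covered by input $u_j$ if $\bar B_{ij}=\star$ for some state $x_i$ in it. A solution of a minimization problem is $\epsilon$-optimal if it is feasible and has cost at most $\epsilon$ times the optimum; an algorithm is $\epsilon$-optimal if it always returns an $\epsilon$-optimal solution. $\log$ is the natural logarithm.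
   Formalization: The ratio proved is 1 + log μ_max instead of log μ_max, which is unattainable: with one state, one input of cost 1 and μ_max = 1, log μ_max = 0 but the only feasible set costs 1. Polynomial time is meant for a unit-cost real-arithmetic machine. *)

theory Defs
  imports
    "HOL-Computational_Algebra.Polynomial"
    "HOL.Transcendental"
    "Graph_Theory.Graph_Theory"
begin

section \<open>Machine model: binary trees with exact real arithmetic\<close>

text \<open>
  Data are binary trees whose leaves are nil or real numbers.  Programs are deeply embedded
  while-programs over such trees (a pure pointer machine with sharing) extended by exact field
  arithmetic and comparison of reals, without rounding and with 0 and 1 as the only real constants.
  As in the real RAM and Blum-Shub-Smale models, every elementary operation takes one step and a
  real number has size one.  Trees are immutable, so copying a value is copying a pointer, and a
  tree is inspected only by testing for nil and by taking components.  Nil is the truth value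
  false, everything else is true.
\<close>

datatype val = VNil | VReal real | VPair val val

primrec vsize :: "val \<Rightarrow> nat" where
  "vsize VNil = 1"
| "vsize (VReal a) = 1"
| "vsize (VPair u v) = 1 + vsize u + vsize v"

datatype arith = Plus | Minus | Times | Divide

datatype prog =
    PId
  | PNil
  | PZero
  | POne
  | PFst
  | PSnd
  | PArith arith
  | PLeq
  | PFork prog prog
  | PSeq prog prog
  | PIf prog prog prog
  | PWhile prog prog

primrec vbool :: "bool \<Rightarrow> val" where
  "vbool True = VPair VNil VNil"
| "vbool False = VNil"

text \<open>Operations applied to a value of the wrong shape yield nil.\<close>

fun vfst :: "val \<Rightarrow> val" where
  "vfst (VPair u v) = u"
| "vfst _ = VNil"

fun vsnd :: "val \<Rightarrow> val" where
  "vsnd (VPair u v) = v"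
| "vsnd _ = VNil"

primrec arith_op :: "arith \<Rightarrow> real \<Rightarrow> real \<Rightarrow> real" where
  "arith_op Plus a b = a + b"
| "arith_op Minus a b = a - b"
| "arith_op Times a b = a * b"
| "arith_op Divide a b = a / b"

fun varith :: "arith \<Rightarrow> val \<Rightarrow> val" where
  "varith f (VPair (VReal a) (VReal b)) = VReal (arith_op f a b)"
| "varith f _ = VNil"

fun vleq :: "val \<Rightarrow> val" where
  "vleq (VPair (VReal a) (VReal b)) = vbool (a \<le> b)"
| "vleq _ = VNil"

text \<open>
  \<open>exec P v t w\<close>: program \<open>P\<close>, started on \<open>v\<close>, halts after \<open>t\<close> steps with result \<open>w\<close>.
\<close>

inductive exec :: "prog \<Rightarrow> val \<Rightarrow> nat \<Rightarrow> val \<Rightarrow> bool" where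
  exec_Id: "exec PId v 1 v"
| exec_Nil: "exec PNil v 1 VNil"
| exec_Zero: "exec PZero v 1 (VReal 0)"
| exec_One: "exec POne v 1 (VReal 1)"
| exec_Fst: "exec PFst v 1 (vfst v)"
| exec_Snd: "exec PSnd v 1 (vsnd v)"
| exec_Arith: "exec (PArith f) v 1 (varith f v)"
| exec_Leq: "exec PLeq v 1 (vleq v)"
| exec_Fork: "exec P v s u \<Longrightarrow> exec Q v t w \<Longrightarrow> exec (PFork P Q) v (s + t + 1) (VPair u w)"
| exec_Seq: "exec P v s u \<Longrightarrow> exec Q u t w \<Longrightarrow> exec (PSeq P Q) v (s + t + 1) w"
| exec_If_true:
    "exec C v s b \<Longrightarrow> b \<noteq> VNil \<Longrightarrow> exec P v t w \<Longrightarrow> exec (PIf C P Q) v (s + t + 1) w"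
| exec_If_false:
    "exec C v s VNil \<Longrightarrow> exec Q v t w \<Longrightarrow> exec (PIf C P Q) v (s + t + 1) w"
| exec_While_stop:
    "exec C v s VNil \<Longrightarrow> exec (PWhile C P) v (s + 1) v"
| exec_While_step:
    "exec C v s b \<Longrightarrow> b \<noteq> VNil \<Longrightarrow> exec P v t u \<Longrightarrow> exec (PWhile C P) u t' w
      \<Longrightarrow> exec (PWhile C P) v (s + t + t' + 1) w"

lemma exec_det: "exec P v t w \<Longrightarrow> exec P v t' w' \<Longrightarrow> t = t' \<and> w = w'"
proof (induct arbitrary: t' w' rule: exec.induct)
  case (exec_While_stop C v s P) from exec_While_stop(3) show ?case
    by cases (use exec_While_stop in blast)+
next
  case (exec_While_step C v s b P t u r w) from exec_While_step(8) show ?case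
    by cases (use exec_While_step in blast)+
next case (exec_Fork P v s u Q t w) from exec_Fork(5) show ?case by cases (use exec_Fork in blast)
next case (exec_Seq P v s u Q t w) from exec_Seq(5) show ?case by cases (use exec_Seq in blast)
next case (exec_If_true C v s b P t w Q) from exec_If_true(6) show ?case by cases (use exec_If_true in blast)+
next case (exec_If_false C v s Q t w P) from exec_If_false(5) show ?case by cases (use exec_If_false in blast)+
qed (auto elim: exec.cases)

primrec vlist :: "val list \<Rightarrow> val" where
  "vlist [] = VNil"
| "vlist (v # vs) = VPair v (vlist vs)"

section \<open>Approximation algorithms for subset selection problems\<close>

text \<open>
  A minimization problem whose solutions are sets of indices from \<open>{1..num_items x}\<close>.
  The input handed to an algorithm is \<open>input x\<close>; its output must be the characteristic
  vector of the selected index set.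
\<close>

record 'i min_problem =
  instances :: "'i set"
  input :: "'i \<Rightarrow> val"
  num_items :: "'i \<Rightarrow> nat"
  feasible :: "'i \<Rightarrow> nat set set"
  cost :: "'i \<Rightarrow> nat set \<Rightarrow> real"

definition enc_subset :: "nat \<Rightarrow> nat set \<Rightarrow> val" where
  "enc_subset k I = vlist (map (\<lambda>i. vbool (i \<in> I)) [1..<Suc k])"

definition optimum :: "'i min_problem \<Rightarrow> 'i \<Rightarrow> real" where
  "optimum \<P> x = Min (cost \<P> x ` feasible \<P> x)"

definition eps_optimal :: "'i min_problem \<Rightarrow> 'i \<Rightarrow> real \<Rightarrow> nat set \<Rightarrow> bool" where
  "eps_optimal \<P> x \<epsilon> I \<longleftrightarrow> I \<in> feasible \<P> x \<and> cost \<P> x I \<le> \<epsilon> * optimum \<P> x"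

text \<open>The ratio may depend on the instance; a constant ratio is \<open>\<lambda>_. \<epsilon>\<close>.\<close>

definition eps_optimal_algorithm :: "'i min_problem \<Rightarrow> ('i \<Rightarrow> real) \<Rightarrow> prog \<Rightarrow> bool" where
  "eps_optimal_algorithm \<P> \<epsilon> P \<longleftrightarrow>
     (\<forall>x \<in> instances \<P>. \<exists>t I. exec P (input \<P> x) t (enc_subset (num_items \<P> x) I)
        \<and> eps_optimal \<P> x (\<epsilon> x) I)"

definition polynomial_time :: "'i min_problem \<Rightarrow> prog \<Rightarrow> bool" where
  "polynomial_time \<P> P \<longleftrightarrow>
     (\<exists>q :: nat poly. \<forall>x \<in> instances \<P>. \<exists>t w.
        exec P (input \<P> x) t w \<and> t \<le> poly q (vsize (input \<P> x)))"

section \<open>Weighted set cover\<close>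

record set_cover_instance =
  universe_size :: nat
  num_sets :: nat
  the_set :: "nat \<Rightarrow> nat set"
  weight :: "nat \<Rightarrow> real"

definition set_cover :: "set_cover_instance min_problem" where
  "set_cover = \<lparr>
     instances = {x. 1 \<le> universe_size x
       \<and> (\<forall>i \<in> {1..num_sets x}. the_set x i \<subseteq> {1..universe_size x})
       \<and> (\<Union>i \<in> {1..num_sets x}. the_set x i) = {1..universe_size x}
       \<and> (\<forall>i \<in> {1..num_sets x}. 0 \<le> weight x i)},
     input = (\<lambda>x. VPair
       (vlist (map (\<lambda>i. vlist (map (\<lambda>k. vbool (k \<in> the_set x i)) [1..<Suc (universe_size x)]))
          [1..<Suc (num_sets x)]))
       (vlist (map (\<lambda>i. VReal (weight x i)) [1..<Suc (num_sets x)]))),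
     num_items = num_sets,
     feasible = (\<lambda>x. {I. I \<subseteq> {1..num_sets x} \<and> (\<Union>i \<in> I. the_set x i) = {1..universe_size x}}),
     cost = (\<lambda>x I. \<Sum>i \<in> I. weight x i)\<rparr>"

section \<open>Structural systems and minimum cost accessibility\<close>

datatype entry = Star | Zero

datatype vertex = X nat | U nat | Y nat

text \<open>Structural matrices are read at the row and column indices \<open>1, 2, \<dots>\<close> of their format only.\<close>

record struct_system =
  n_states :: nat
  n_inputs :: nat
  n_outputs :: nat
  A_mat :: "nat \<Rightarrow> nat \<Rightarrow> entry"
  B_mat :: "nat \<Rightarrow> nat \<Rightarrow> entry"
  C_mat :: "nat \<Rightarrow> nat \<Rightarrow> entry"
  K_mat :: "nat \<Rightarrow> nat \<Rightarrow> entry"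
  input_cost :: "nat \<Rightarrow> real"

definition state_digraph :: "struct_system \<Rightarrow> vertex pair_pre_digraph" where
  "state_digraph \<Sigma> = \<lparr>
     pverts = X ` {1..n_states \<Sigma>},
     parcs = {(X j, X i) | i j. i \<in> {1..n_states \<Sigma>} \<and> j \<in> {1..n_states \<Sigma>} \<and> A_mat \<Sigma> i j = Star}\<rparr>"

text \<open>The system digraph in which only the inputs in \<open>I\<close> are present.\<close>

definition system_digraph :: "struct_system \<Rightarrow> nat set \<Rightarrow> vertex pair_pre_digraph" where
  "system_digraph \<Sigma> I = \<lparr>
     pverts = X ` {1..n_states \<Sigma>} \<union> U ` I \<union> Y ` {1..n_outputs \<Sigma>},
     parcs = parcs (state_digraph \<Sigma>)
       \<union> {(U j, X i) | i j. i \<in> {1..n_states \<Sigma>} \<and> j \<in> I \<and> B_mat \<Sigma> i j = Star}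
       \<union> {(X j, Y i) | i j. i \<in> {1..n_outputs \<Sigma>} \<and> j \<in> {1..n_states \<Sigma>} \<and> C_mat \<Sigma> i j = Star}
       \<union> {(Y j, U i) | i j. i \<in> I \<and> j \<in> {1..n_outputs \<Sigma>} \<and> K_mat \<Sigma> i j = Star}\<rparr>"

definition accessible :: "struct_system \<Rightarrow> nat set \<Rightarrow> nat \<Rightarrow> bool" where
  "accessible \<Sigma> I i \<longleftrightarrow>
     (\<exists>j \<in> I. \<exists>p. pre_digraph.apath (with_proj (system_digraph \<Sigma> I)) (U j) p (X i))"

definition accessible_inputs :: "struct_system \<Rightarrow> nat set set" where
  "accessible_inputs \<Sigma> =
     {I. I \<subseteq> {1..n_inputs \<Sigma>} \<and> (\<forall>i \<in> {1..n_states \<Sigma>}. accessible \<Sigma> I i)}"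

text \<open>
  The algorithm is given \<open>A\<close>, \<open>B\<close> and the input costs, but not \<open>C\<close> and \<open>K\<close>: its answer has to be
  good for all of them.
\<close>

definition min_cost_accessibility :: "struct_system min_problem" where
  "min_cost_accessibility = \<lparr>
     instances = {\<Sigma>. 1 \<le> n_states \<Sigma>
       \<and> (\<forall>j \<in> {1..n_inputs \<Sigma>}. 0 \<le> input_cost \<Sigma> j)
       \<and> {1..n_inputs \<Sigma>} \<in> accessible_inputs \<Sigma>},
     input = (\<lambda>\<Sigma>. VPair
       (vlist (map (\<lambda>i. vlist (map (\<lambda>j. vbool (A_mat \<Sigma> i j = Star)) [1..<Suc (n_states \<Sigma>)]))
          [1..<Suc (n_states \<Sigma>)]))
       (VPair
         (vlist (map (\<lambda>i. vlist (map (\<lambda>j. vbool (B_mat \<Sigma> i j = Star)) [1..<Suc (n_inputs \<Sigma>)]))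
            [1..<Suc (n_states \<Sigma>)]))
         (vlist (map (\<lambda>j. VReal (input_cost \<Sigma> j)) [1..<Suc (n_inputs \<Sigma>)])))),
     num_items = n_inputs,
     feasible = accessible_inputs,
     cost = (\<lambda>\<Sigma> I. \<Sum>j \<in> I. input_cost \<Sigma> j)\<rparr>"

definition state_sccs :: "struct_system \<Rightarrow> vertex set set" where
  "state_sccs \<Sigma> = pre_digraph.sccs_verts (with_proj (state_digraph \<Sigma>))"

definition non_top_linked :: "struct_system \<Rightarrow> vertex set \<Rightarrow> bool" where
  "non_top_linked \<Sigma> S \<longleftrightarrow> S \<in> state_sccs \<Sigma> \<and>
     \<not> (\<exists>T \<in> state_sccs \<Sigma>. T \<noteq> S \<and> (\<exists>u \<in> T. \<exists>v \<in> S. (u, v) \<in> parcs (state_digraph \<Sigma>)))"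

definition covered_by :: "struct_system \<Rightarrow> vertex set \<Rightarrow> nat \<Rightarrow> bool" where
  "covered_by \<Sigma> S j \<longleftrightarrow> (\<exists>i. X i \<in> S \<and> B_mat \<Sigma> i j = Star)"

definition mu_max :: "struct_system \<Rightarrow> nat" where
  "mu_max \<Sigma> = Max ((\<lambda>j. card {S. non_top_linked \<Sigma> S \<and> covered_by \<Sigma> S j}) ` {1..n_inputs \<Sigma>})"

text \<open>
  On the ratio \<open>1 + ln (mu_max \<Sigma>)\<close>: the greedy algorithm for set cover with sets of size at most
  \<open>d\<close> has ratio \<open>1 + 1/2 + \<dots> + 1/d \<le> 1 + ln d\<close>.  The leading term \<open>ln d\<close> alone is less than 1
  for \<open>d \<le> 2\<close> (and 0 for \<open>d = 1\<close>), so that no algorithm attains it.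
\<close>

end

theory Submission
  imports Defs
begin

text \<open>
  An input \<open>j\<close> serves a state \<open>i\<close> if some state adjacent to \<open>j\<close> has a path to \<open>i\<close> in the state digraph.
  Outputs and feedback are irrelevant for accessibility, because a path that leaves an input of \<open>I\<close>
  through feedback re-enters the states through another input of \<open>I\<close>.  Hence \<open>I\<close> is feasible iff its
  members jointly hit every row of the Boolean matrix ``state \<open>i\<close> is served by input \<open>j\<close>'', and it
  suffices to hit the distinct inclusion-minimal rows.  This is a set cover instance with the same
  solutions and the same costs.  A state with a minimal row has an ancestor with the same row in a
  non-top linked component, and states of one component have equal rows, so the minimal rows inject
  into the non-top linked components; the set of \<open>j\<close> therefore has at most \<open>mu_max\<close> elements, and
  the greedy algorithm for set cover has ratio \<open>1 + ln mu_max\<close>.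

  Programs are obtained from closure properties of the polynomial time functions on Booleans, reals,
  pairs and lists.  The essential one is iteration over a list, which needs a polynomial bound on the
  size of all intermediate accumulators: trees are shared, so a short run can build a huge tree.
\<close>

section \<open>Polynomial time functions\<close>

text \<open>Two features of the model shape the proof. The machine has no natural numbers, so
  counters and indices are reals, and the number of rounds of a loop is the length of some list at
  hand. Polynomial time is proved for total functions on all data of a type, so every size bound has
  to hold for ragged matrices as well; the row operations go through \<open>zip\<close>, whose
  truncation keeps the dimensions under control. The first claim rests on solutions and costs being
  the same on both sides. Restricting to minimal rows is what the second claim requires: with all
  rows kept, the set of an input would also contain the states far below the components that it
  covers, and \<open>mu_max\<close> would not bound its size. The logarithm comes from the classical
  charging argument for greedy covers, cast as an inequality between cost and potential that every
  round preserves.\<close>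

class encodable =
  fixes enc :: "'a \<Rightarrow> val"

instantiation bool :: encodable
begin
definition "enc_bool = vbool"
instance ..
end

instantiation real :: encodable
begin
definition "enc_real = VReal"
instance ..
end

instantiation list :: (encodable) encodable
begin
definition "enc_list (xs :: 'a list) = vlist (map enc xs)"
instance ..
end

instantiation prod :: (encodable, encodable) encodable
begin
definition "enc_prod (p :: 'a \<times> 'b) = VPair (enc (fst p)) (enc (snd p))"
instance ..
end

lemma enc_list_simps [simp]:
  "enc [] = VNil" "enc (x # xs) = VPair (enc x) (enc xs)"
  by (simp_all add: enc_list_def)

lemma enc_pair [simp]: "enc (x, y) = VPair (enc x) (enc y)"
  by (simp add: enc_prod_def)

text \<open>The times are written \<open>Suc 0\<close> because the simplifier turns the number 1
  into this form.\<close>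

lemma exec_instruction_iff [simp]:
  "exec PId v (Suc 0) w \<longleftrightarrow> w = v"
  "exec PNil v (Suc 0) w \<longleftrightarrow> w = VNil"
  "exec PZero v (Suc 0) w \<longleftrightarrow> w = VReal 0"
  "exec POne v (Suc 0) w \<longleftrightarrow> w = VReal 1"
  "exec PFst v (Suc 0) w \<longleftrightarrow> w = vfst v"
  "exec PSnd v (Suc 0) w \<longleftrightarrow> w = vsnd v"
  "exec (PArith f) v (Suc 0) w \<longleftrightarrow> w = varith f v"
  "exec PLeq v (Suc 0) w \<longleftrightarrow> w = vleq v"
  using exec.intros(1-8) by (auto elim: exec.cases)

lemma vsize_vbool_le: "vsize (enc (b :: bool)) \<le> 3"
  by (cases b) (simp_all add: enc_bool_def)

lemma vsize_real [simp]: "vsize (enc (r :: real)) = 1"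
  by (simp add: enc_real_def)

lemma vsize_pos: "1 \<le> vsize v"
  by (cases v) auto

lemma vsize_mem: "y \<in> set xs \<Longrightarrow> vsize (enc y) < vsize (enc xs)"
  by (induction xs) auto

lemma length_less_vsize: "length xs < vsize (enc xs)"
proof (induction xs)
  case (Cons a xs)
  then show ?case using vsize_pos[of "enc a"] by simp
qed simp

lemma vsize_list_le:
  assumes "\<And>y. y \<in> set xs \<Longrightarrow> vsize (enc y) \<le> M"
  shows "vsize (enc xs) \<le> 1 + length xs * (1 + M)"
  using assms
proof (induction xs)
  case (Cons a xs)
  then have "vsize (enc a) \<le> M" "vsize (enc xs) \<le> 1 + length xs * (1 + M)" by auto
  then show ?case by simp
qed simp

text \<open>Coefficients in \<open>nat\<close> are nonnegative, so a size may be enlarged inside a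
  polynomial.\<close>

lemma poly_nat_mono: "m \<le> n \<Longrightarrow> poly q m \<le> poly q n" for m n :: nat
  by (induction q) (auto intro!: add_mono mult_mono)

section \<open>Polynomial bounds and polynomial time functions\<close>

definition poly_bounded :: "('a::encodable \<Rightarrow> nat) \<Rightarrow> bool" where
  "poly_bounded b \<longleftrightarrow> (\<exists>q. \<forall>x. b x \<le> poly q (vsize (enc x)))"

text \<open>Composition charges the second program by the size of the intermediate result, so the
  polynomial bounds that size together with the time.\<close>

definition ptime :: "('a::encodable \<Rightarrow> 'b::encodable) \<Rightarrow> bool" where
  "ptime f \<longleftrightarrow> (\<exists>P q. \<forall>x. \<exists>t. exec P (enc x) t (enc (f x))
     \<and> t + vsize (enc (f x)) \<le> poly q (vsize (enc x)))"

lemma poly_bounded_mono: "poly_bounded c \<Longrightarrow> (\<And>x. b x \<le> c x) \<Longrightarrow> poly_bounded b"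
  unfolding poly_bounded_def by (meson le_trans)

lemma poly_bounded_const: "poly_bounded (\<lambda>x. c)"
  unfolding poly_bounded_def by (rule exI[of _ "[:c:]"]) simp

lemma poly_bounded_vsize: "poly_bounded (\<lambda>x. vsize (enc x))"
  unfolding poly_bounded_def by (rule exI[of _ "[:0, 1:]"]) simp

lemma poly_bounded_poly: "poly_bounded b \<Longrightarrow> poly_bounded (\<lambda>x. poly q (b x))"
  unfolding poly_bounded_def
proof (elim exE)
  fix r assume "\<forall>x. b x \<le> poly r (vsize (enc x))"
  then have "\<forall>x. poly q (b x) \<le> poly (pcompose q r) (vsize (enc x))"
    by (simp add: poly_pcompose poly_nat_mono)
  then show "\<exists>r. \<forall>x. poly q (b x) \<le> poly r (vsize (enc x))" ..
qed

lemma poly_bounded_add: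
  "poly_bounded b \<Longrightarrow> poly_bounded c \<Longrightarrow> poly_bounded (\<lambda>x. b x + c x)"
  unfolding poly_bounded_def
proof (elim exE)
  fix q r assume "\<forall>x. b x \<le> poly q (vsize (enc x))" "\<forall>x. c x \<le> poly r (vsize (enc x))"
  then have "\<forall>x. b x + c x \<le> poly (q + r) (vsize (enc x))"
    by (simp add: add_mono)
  then show "\<exists>s. \<forall>x. b x + c x \<le> poly s (vsize (enc x))" ..
qed

lemma poly_bounded_mult:
  "poly_bounded b \<Longrightarrow> poly_bounded c \<Longrightarrow> poly_bounded (\<lambda>x. b x * c x)"
  unfolding poly_bounded_def
proof (elim exE)
  fix q r assume "\<forall>x. b x \<le> poly q (vsize (enc x))" "\<forall>x. c x \<le> poly r (vsize (enc x))"
  then have "\<forall>x. b x * c x \<le> poly (q * r) (vsize (enc x))"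
    by (simp add: mult_le_mono)
  then show "\<exists>s. \<forall>x. b x * c x \<le> poly s (vsize (enc x))" ..
qed

lemma ptimeI:
  assumes "\<And>x. \<exists>t \<le> T x. exec P (enc x) t (enc (f x))"
    and "poly_bounded T" "poly_bounded (\<lambda>x. vsize (enc (f x)))"
  shows "ptime f"
proof -
  from poly_bounded_add[OF assms(2,3)]
  obtain q where q: "\<And>x. T x + vsize (enc (f x)) \<le> poly q (vsize (enc x))"
    unfolding poly_bounded_def by auto
  have "\<forall>x. \<exists>t. exec P (enc x) t (enc (f x)) \<and> t + vsize (enc (f x)) \<le> poly q (vsize (enc x))"
  proof
    fix x
    from assms(1)[of x] obtain t where "t \<le> T x" "exec P (enc x) t (enc (f x))" by auto
    with q[of x] show "\<exists>t. exec P (enc x) t (enc (f x))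
        \<and> t + vsize (enc (f x)) \<le> poly q (vsize (enc x))"
      by (intro exI[of _ t]) auto
  qed
  then show ?thesis unfolding ptime_def by blast
qed

lemma ptimeE:
  assumes "ptime f"
  obtains P T where "\<And>x. exec P (enc x) (T x) (enc (f x))" "poly_bounded T"
    "poly_bounded (\<lambda>x. vsize (enc (f x)))"
proof -
  from assms obtain P q where *: "\<forall>x. \<exists>t. exec P (enc x) t (enc (f x))
     \<and> t + vsize (enc (f x)) \<le> poly q (vsize (enc x))"
    unfolding ptime_def by auto
  then obtain T where T: "\<And>x. exec P (enc x) (T x) (enc (f x))"
    "\<And>x. T x + vsize (enc (f x)) \<le> poly q (vsize (enc x))"
    by metis
  have "poly_bounded T" "poly_bounded (\<lambda>x. vsize (enc (f x)))"
    unfolding poly_bounded_def using add_leD1[OF T(2)] add_leD2[OF T(2)] by blast+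
  with T(1) show thesis by (rule that)
qed

lemma poly_bounded_vsize_ptime: "ptime f \<Longrightarrow> poly_bounded (\<lambda>x. vsize (enc (f x)))"
  by (erule ptimeE)

lemma poly_bounded_compose:
  assumes "poly_bounded b" "ptime f"
  shows "poly_bounded (\<lambda>x. b (f x))"
proof -
  from assms(1) obtain q where "\<And>y. b y \<le> poly q (vsize (enc y))"
    unfolding poly_bounded_def by auto
  then show ?thesis
    by (intro poly_bounded_mono[OF poly_bounded_poly[OF poly_bounded_vsize_ptime[OF assms(2)]]])
qed

lemma poly_bounded_length:
  assumes "ptime l" shows "poly_bounded (\<lambda>x. length (l x))"
  using poly_bounded_vsize_ptime[OF assms]
  by (rule poly_bounded_mono) (rule less_imp_le[OF length_less_vsize])

lemmas poly_bounded_intros = poly_bounded_add poly_bounded_mult poly_bounded_const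
  poly_bounded_poly poly_bounded_vsize poly_bounded_vsize_ptime poly_bounded_length

section \<open>Closure under composition, instructions and branching\<close>

named_theorems ptime_intros

lemma ptime_id [ptime_intros]: "ptime (\<lambda>x. x)"
  by (rule ptimeI[of "\<lambda>x. 1" PId])
    (use exec_Id in \<open>auto intro: poly_bounded_intros\<close>)

lemma ptime_compose:
  assumes "ptime g" "ptime f" shows "ptime (\<lambda>x. g (f x))"
proof -
  from assms(1) obtain P T where g: "\<And>x. exec P (enc x) (T x) (enc (g x))" "poly_bounded T"
    "poly_bounded (\<lambda>x. vsize (enc (g x)))" by (rule ptimeE) blast
  from assms(2) obtain Q U where f: "\<And>x. exec Q (enc x) (U x) (enc (f x))" "poly_bounded U"
    by (rule ptimeE) blast
  show ?thesis
  proof (rule ptimeI[of "\<lambda>x. U x + T (f x) + 1" "PSeq Q P"])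
    show "\<exists>t\<le>U x + T (f x) + 1. exec (PSeq Q P) (enc x) t (enc (g (f x)))" for x
      using exec_Seq[OF f(1) g(1)] by blast
  qed (intro poly_bounded_intros f g poly_bounded_compose[OF _ assms(2)])+
qed

lemma ptime_Pair [ptime_intros]:
  assumes "ptime f" "ptime g" shows "ptime (\<lambda>x. (f x, g x))"
proof -
  from assms(1) obtain P T where f: "\<And>x. exec P (enc x) (T x) (enc (f x))" "poly_bounded T"
    by (rule ptimeE) blast
  from assms(2) obtain Q U where g: "\<And>x. exec Q (enc x) (U x) (enc (g x))" "poly_bounded U"
    by (rule ptimeE) blast
  show ?thesis
  proof (rule ptimeI[of "\<lambda>x. T x + U x + 1" "PFork P Q"])
    show "\<exists>t\<le>T x + U x + 1. exec (PFork P Q) (enc x) t (enc (f x, g x))" for x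
      using exec_Fork[OF f(1) g(1)] by auto
    have "poly_bounded (\<lambda>x. 1 + (vsize (enc (f x)) + vsize (enc (g x))))"
      by (intro poly_bounded_intros assms)
    then show "poly_bounded (\<lambda>x. vsize (enc (f x, g x)))"
      by simp
  qed (intro poly_bounded_intros f g)
qed

text \<open>The slack \<open>c\<close> accounts for results that are not contained in the argument,
  such as constants and truth values.\<close>

lemma ptime_instruction:
  assumes "\<And>x. exec P (enc x) 1 (enc (f x))" "\<And>x. vsize (enc (f x)) \<le> vsize (enc x) + c"
  shows "ptime f"
proof (rule ptimeI[of "\<lambda>x. 1" P f])
  have "poly_bounded (\<lambda>x :: 'a. vsize (enc x) + c)"
    by (intro poly_bounded_intros)
  then show "poly_bounded (\<lambda>x. vsize (enc (f x)))"
    by (rule poly_bounded_mono) (rule assms(2))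
qed (use assms(1) in \<open>auto intro: poly_bounded_const\<close>)

lemma ptime_fst [ptime_intros]:
  fixes f :: "'a::encodable \<Rightarrow> 'b::encodable \<times> 'c::encodable"
  assumes "ptime f"
  shows "ptime (\<lambda>x. fst (f x))"
proof -
  have "ptime (fst :: 'b \<times> 'c \<Rightarrow> _)"
    by (rule ptime_instruction[of PFst _ 0]) (auto simp: enc_prod_def)
  from ptime_compose[OF this assms] show ?thesis .
qed

lemma ptime_snd [ptime_intros]:
  fixes f :: "'a::encodable \<Rightarrow> 'b::encodable \<times> 'c::encodable"
  assumes "ptime f"
  shows "ptime (\<lambda>x. snd (f x))"
proof -
  have "ptime (snd :: 'b \<times> 'c \<Rightarrow> _)"
    by (rule ptime_instruction[of PSnd _ 0]) (auto simp: enc_prod_def)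
  from ptime_compose[OF this assms] show ?thesis .
qed

lemma ptime_compose2:
  "ptime (\<lambda>p. g (fst p) (snd p)) \<Longrightarrow> ptime f \<Longrightarrow> ptime h \<Longrightarrow> ptime (\<lambda>x. g (f x) (h x))"
  using ptime_compose[OF _ ptime_Pair, of "\<lambda>p. g (fst p) (snd p)" f h] by simp

lemma ptime_arith:
  assumes "ptime f" "ptime g"
  shows "ptime (\<lambda>x. arith_op a (f x) (g x))"
proof -
  have "ptime (\<lambda>p. arith_op a (fst p) (snd p))"
    by (rule ptime_instruction[of "PArith a" _ 0]) (auto simp: enc_prod_def enc_real_def)
  from ptime_compose2[OF this assms] show ?thesis .
qed

lemma ptime_plus [ptime_intros]: "ptime f \<Longrightarrow> ptime g \<Longrightarrow> ptime (\<lambda>x. f x + g x :: real)"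
  and ptime_times [ptime_intros]: "ptime f \<Longrightarrow> ptime g \<Longrightarrow> ptime (\<lambda>x. f x * g x :: real)"
  using ptime_arith[of f g Plus] ptime_arith[of f g Times] by simp_all

lemma ptime_leq [ptime_intros]:
  fixes f g :: "'a::encodable \<Rightarrow> real"
  assumes "ptime f" "ptime g"
  shows "ptime (\<lambda>x. f x \<le> g x)"
proof -
  have "ptime (\<lambda>p. fst p \<le> (snd p :: real))"
  proof (rule ptime_instruction[of PLeq _ 3])
    show "exec PLeq (enc p) 1 (enc (fst p \<le> snd p))" for p :: "real \<times> real"
      by (simp add: enc_prod_def enc_real_def enc_bool_def)
    show "vsize (enc (fst p \<le> snd p)) \<le> vsize (enc p) + 3" for p :: "real \<times> real"
      using vsize_vbool_le by (rule trans_le_add2)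
  qed
  from ptime_compose2[OF this assms] show ?thesis .
qed

lemma ptime_zero [ptime_intros]: "ptime (\<lambda>x. 0 :: real)"
  by (rule ptime_instruction[of PZero _ 1]) (auto simp: enc_real_def)

lemma ptime_one [ptime_intros]: "ptime (\<lambda>x. 1 :: real)"
  by (rule ptime_instruction[of POne _ 1]) (auto simp: enc_real_def)

lemma ptime_Nil [ptime_intros]: "ptime (\<lambda>x. [])"
  by (rule ptime_instruction[of PNil _ 1]) (auto)

lemma ptime_False [ptime_intros]: "ptime (\<lambda>x. False)"
  by (rule ptime_instruction[of PNil _ 1]) (auto simp: enc_bool_def)

lemma ptime_True [ptime_intros]: "ptime (\<lambda>x. True)"
  using exec_Fork[OF exec_Nil exec_Nil]
  by (intro ptimeI[of "\<lambda>x. 3" "PFork PNil PNil"] poly_bounded_const) (auto simp: enc_bool_def numeral_3_eq_3)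

lemma ptime_Cons [ptime_intros]:
  assumes "ptime f" "ptime g"
  shows "ptime (\<lambda>x. f x # g x)"
proof -
  have "ptime (\<lambda>p. fst p # snd p :: 'b list)"
    by (rule ptime_instruction[of PId _ 0]) (auto simp: enc_prod_def)
  from ptime_compose2[OF this assms] show ?thesis .
qed

lemma ptime_if [ptime_intros]:
  assumes "ptime b" "ptime f" "ptime g"
  shows "ptime (\<lambda>x. if b x then f x else g x)"
proof -
  from assms(1) obtain B R where b: "\<And>x. exec B (enc x) (R x) (enc (b x))" "poly_bounded R"
    by (rule ptimeE) blast
  from assms(2) obtain P T where f: "\<And>x. exec P (enc x) (T x) (enc (f x))" "poly_bounded T"
    by (rule ptimeE) blast
  from assms(3) obtain Q U where g: "\<And>x. exec Q (enc x) (U x) (enc (g x))" "poly_bounded U"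
    by (rule ptimeE) blast
  show ?thesis
  proof (rule ptimeI[of "\<lambda>x. R x + (T x + U x) + 1" "PIf B P Q"])
    show "\<exists>t\<le>R x + (T x + U x) + 1. exec (PIf B P Q) (enc x) t (enc (if b x then f x else g x))" for x
    proof (cases "b x")
      case True
      then show ?thesis using exec_If_true[OF b(1)[of x] _ f(1)[of x]]
        by (intro exI[of _ "R x + T x + 1"]) (auto simp: enc_bool_def)
    next
      case False
      then have "exec B (enc x) (R x) VNil" using b(1)[of x] by (simp add: enc_bool_def)
      from exec_If_false[OF this g(1)[of x]] False show ?thesis
        by (intro exI[of _ "R x + U x + 1"]) auto
    qed
    have "poly_bounded (\<lambda>x. vsize (enc (f x)) + vsize (enc (g x)))"
      by (intro poly_bounded_intros assms)
    then show "poly_bounded (\<lambda>x. vsize (enc (if b x then f x else g x)))"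
      by (rule poly_bounded_mono) simp
  qed (intro poly_bounded_intros b f g)
qed

lemma ptime_not [ptime_intros]: "ptime b \<Longrightarrow> ptime (\<lambda>x. \<not> b x)"
proof -
  assume "ptime b"
  from ptime_if[OF this ptime_False ptime_True] show ?thesis
    by (rule back_subst[of ptime]) auto
qed

lemma ptime_conj [ptime_intros]: "ptime b \<Longrightarrow> ptime c \<Longrightarrow> ptime (\<lambda>x. b x \<and> c x)"
proof -
  assume "ptime b" "ptime c"
  from ptime_if[OF this ptime_False] show ?thesis
    by (rule back_subst[of ptime]) auto
qed

lemma ptime_disj [ptime_intros]: "ptime b \<Longrightarrow> ptime c \<Longrightarrow> ptime (\<lambda>x. b x \<or> c x)"
proof -
  assume "ptime b" "ptime c"
  from ptime_if[OF this(1) ptime_True this(2)] show ?thesis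
    by (rule back_subst[of ptime]) auto
qed

section \<open>Case distinction and iteration over lists\<close>

lemma ptime_case_list [ptime_intros]:
  assumes "ptime l" "ptime f" "ptime (\<lambda>p. g (fst p) (fst (snd p)) (snd (snd p)))"
  shows "ptime (\<lambda>x. case l x of [] \<Rightarrow> f x | y # ys \<Rightarrow> g x y ys)"
proof -
  from assms(1) obtain L R where l: "\<And>x. exec L (enc x) (R x) (enc (l x))" "poly_bounded R"
    by (rule ptimeE) blast
  from assms(2) obtain P T where f: "\<And>x. exec P (enc x) (T x) (enc (f x))" "poly_bounded T"
    by (rule ptimeE) blast
  from assms(3) obtain Q U
    where Q: "\<And>p. exec Q (enc p) (U p) (enc (g (fst p) (fst (snd p)) (snd (snd p))))"
    and U: "poly_bounded U" and S: "poly_bounded (\<lambda>p. vsize (enc (g (fst p) (fst (snd p)) (snd (snd p)))))"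
    by (rule ptimeE) blast
  have g: "exec Q (enc (x, y, ys)) (U (x, y, ys)) (enc (g x y ys))" for x y ys
    using Q[of "(x, y, ys)"] by simp
  from U obtain u where u: "\<And>p. U p \<le> poly u (vsize (enc p))" unfolding poly_bounded_def by blast
  from S obtain s where S: "\<And>p. vsize (enc (g (fst p) (fst (snd p)) (snd (snd p)))) \<le> poly s (vsize (enc p))"
    unfolding poly_bounded_def by blast
  have s: "vsize (enc (g x y ys)) \<le> poly s (vsize (enc (x, y, ys)))" for x y ys
    using S[of "(x, y, ys)"] by simp
  let ?Q = "PSeq (PFork PId (PFork (PSeq L PFst) (PSeq L PSnd))) Q"
  \<comment> \<open>Exactly the size of the triple \<open>(x, y, ys)\<close> when
    \<open>l x = y # ys\<close>.\<close>
  let ?N = "\<lambda>x. vsize (enc x) + vsize (enc (l x)) + 1"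
  show ?thesis
  \<comment> \<open>\<open>L\<close> runs up to three times: as the test and once for each
    component.\<close>
  proof (rule ptimeI[of "\<lambda>x. 3 * R x + T x + poly u (?N x) + 10" "PIf L ?Q P"])
    show "\<exists>t\<le>3 * R x + T x + poly u (?N x) + 10. exec (PIf L ?Q P) (enc x) t
        (enc (case l x of [] \<Rightarrow> f x | y # ys \<Rightarrow> g x y ys))" for x
    proof (cases "l x")
      case Nil
      then have "exec L (enc x) (R x) VNil" using l(1)[of x] by simp
      from exec_If_false[OF this f(1)[of x]] Nil show ?thesis
        by (intro exI[of _ "R x + T x + 1"]) auto
    next
      case (Cons y ys)
      then have L: "exec L (enc x) (R x) (VPair (enc y) (enc ys))" using l(1)[of x] by simp
      have 1: "exec (PSeq L PFst) (enc x) (R x + 1 + 1) (enc y)"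
        using exec_Seq[OF L exec_Fst] by simp
      have 2: "exec (PSeq L PSnd) (enc x) (R x + 1 + 1) (enc ys)"
        using exec_Seq[OF L exec_Snd] by simp
      have 3: "exec (PFork PId (PFork (PSeq L PFst) (PSeq L PSnd))) (enc x) (2 * R x + 7) (enc (x, y, ys))"
        using exec_Fork[OF exec_Id exec_Fork[OF 1 2]] by (simp add: numeral_eq_Suc)
      note 4 = exec_If_true[OF L _ exec_Seq[OF 3 g]]
      have "U (x, y, ys) \<le> poly u (?N x)"
        using u[of "(x, y, ys)"] poly_nat_mono[of "vsize (enc (x, y, ys))" "?N x" u] Cons by simp
      with 4 Cons show ?thesis
        by (intro exI[of _ "R x + (2 * R x + 7 + U (x, y, ys) + 1) + 1"]) simp
    qed
    have "poly_bounded (\<lambda>x. vsize (enc (f x)) + poly s (?N x))"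
      by (intro poly_bounded_intros assms)
    then show "poly_bounded (\<lambda>x. vsize (enc (case l x of [] \<Rightarrow> f x | y # ys \<Rightarrow> g x y ys)))"
    proof (rule poly_bounded_mono)
      show "vsize (enc (case l x of [] \<Rightarrow> f x | y # ys \<Rightarrow> g x y ys)) \<le> vsize (enc (f x)) + poly s (?N x)" for x
      proof (cases "l x")
        case (Cons y ys)
        then show ?thesis
          using s[of x y ys] poly_nat_mono[of "vsize (enc (x, y, ys))" "?N x" s] by simp
      qed simp
    qed
  qed (intro poly_bounded_intros l f assms)
qed

text \<open>The accumulators of a run are the folds of the prefixes of \<open>l x\<close>, hence the
  bound over all \<open>take k\<close>. The argument \<open>x\<close> is an environment that stays
  fixed during the loop, so that the step may use whatever can be computed from it.\<close>

lemma ptime_foldl: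
  assumes "ptime l" "ptime i" and G: "ptime (\<lambda>p. g (fst p) (fst (snd p)) (snd (snd p)))"
    and b: "poly_bounded b"
    and acc: "\<And>x k. k \<le> length (l x) \<Longrightarrow> vsize (enc (foldl (g x) (i x) (take k (l x)))) \<le> b x"
  shows "ptime (\<lambda>x. foldl (g x) (i x) (l x))"
proof -
  from assms(1) obtain L R where l: "\<And>x. exec L (enc x) (R x) (enc (l x))" "poly_bounded R"
    by (rule ptimeE) blast
  from assms(2) obtain I T where i: "\<And>x. exec I (enc x) (T x) (enc (i x))" "poly_bounded T"
    by (rule ptimeE) blast
  from G obtain Q U
    where Q: "\<And>p. exec Q (enc p) (U p) (enc (g (fst p) (fst (snd p)) (snd (snd p))))"
    and U: "poly_bounded U"
    by (rule ptimeE) blast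
  have g: "exec Q (enc (x, a, y)) (U (x, a, y)) (enc (g x a y))" for x a y
    using Q[of "(x, a, y)"] by simp
  from U obtain u where u: "\<And>p. U p \<le> poly u (vsize (enc p))" unfolding poly_bounded_def by blast
  define arg where "arg = PFork (PSeq PSnd PFst) (PFork (PSeq PSnd PSnd) (PSeq PFst PFst))"
  \<comment> \<open>The loop state consists of the remaining list, the environment and the
    accumulator. \<open>PFst\<close> returns the remaining list and thus serves as the loop test,
    the empty list being the only one encoded as nil.\<close>
  define body where "body = PFork (PSeq PFst PSnd) (PFork (PSeq PSnd PFst) (PSeq arg Q))"
  have body: "exec body (VPair (enc (y # ys)) (VPair (enc x) (enc a))) (20 + U (x, a, y))
      (VPair (enc ys) (VPair (enc x) (enc (g x a y))))" for x a y ys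
  proof -
    let ?s = "VPair (enc (y # ys)) (VPair (enc x) (enc a))"
    have 1: "exec (PSeq PSnd PFst) ?s 3 (enc x)" "exec (PSeq PSnd PSnd) ?s 3 (enc a)"
      "exec (PSeq PFst PFst) ?s 3 (enc y)" "exec (PSeq PFst PSnd) ?s 3 (enc ys)"
      using exec_Seq[OF exec_Snd exec_Fst, of ?s] exec_Seq[OF exec_Snd exec_Snd, of ?s]
        exec_Seq[OF exec_Fst exec_Fst, of ?s] exec_Seq[OF exec_Fst exec_Snd, of ?s]
      by (simp_all add: numeral_3_eq_3)
    have 2: "exec arg ?s 11 (enc (x, a, y))"
      using exec_Fork[OF 1(1) exec_Fork[OF 1(2,3)]] by (simp add: arg_def)
    from exec_Fork[OF 1(4) exec_Fork[OF 1(1) exec_Seq[OF 2 g]]] show ?thesis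
      by (simp add: body_def)
  qed
  \<comment> \<open>\<open>c\<close> and \<open>d\<close> are fixed numbers, so that the induction
    may advance \<open>a\<close> and shorten the list without touching the bound. A round costs 22
    steps besides the run of \<open>Q\<close>: 20 for \<open>body\<close>, one for the test, one for
    the loop itself. The 2 inside the polynomial are the pair nodes of \<open>(x, a, y)\<close>, the
    last 2 pay for leaving the loop.\<close>
  have loop: "\<exists>t \<le> length ys * (poly u (vsize (enc x) + c + d + 2) + 22) + 2.
      exec (PWhile PFst body) (VPair (enc ys) (VPair (enc x) (enc a))) t
        (VPair VNil (VPair (enc x) (enc (foldl (g x) a ys))))"
    if "\<And>k. k \<le> length ys \<Longrightarrow> vsize (enc (foldl (g x) a (take k ys))) \<le> c"
      and "\<And>y. y \<in> set ys \<Longrightarrow> vsize (enc y) \<le> d" for ys x a c d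
    using that
  proof (induction ys arbitrary: a)
    case Nil
    have "exec PFst (VPair VNil (VPair (enc x) (enc a))) 1 VNil"
      using exec_Fst[of "VPair VNil (VPair (enc x) (enc a))"] by simp
    from exec_While_stop[OF this] show ?case by auto
  next
    case (Cons y ys)
    have "vsize (enc (foldl (g x) (g x a y) (take k ys))) \<le> c" if "k \<le> length ys" for k
      using Cons.prems(1)[of "Suc k"] that by simp
    from Cons.IH[OF this] Cons.prems(2) obtain t where
      t: "t \<le> length ys * (poly u (vsize (enc x) + c + d + 2) + 22) + 2"
      "exec (PWhile PFst body) (VPair (enc ys) (VPair (enc x) (enc (g x a y)))) t
        (VPair VNil (VPair (enc x) (enc (foldl (g x) (g x a y) ys))))"
      by auto
    have c: "exec PFst (VPair (enc (y # ys)) (VPair (enc x) (enc a))) 1 (VPair (enc y) (enc ys))"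
      using exec_Fst[of "VPair (enc (y # ys)) (VPair (enc x) (enc a))"] by simp
    have "vsize (enc a) \<le> c" "vsize (enc y) \<le> d" using Cons.prems(1)[of 0] Cons.prems(2) by auto
    then have "U (x, a, y) \<le> poly u (vsize (enc x) + c + d + 2)"
      using u[of "(x, a, y)"] poly_nat_mono[of "vsize (enc (x, a, y))" "vsize (enc x) + c + d + 2" u] by simp
    with exec_While_step[OF c _ body t(2)] t(1) show ?case
      by (intro exI[of _ "1 + (20 + U (x, a, y)) + t + 1"]) auto
  qed
  let ?N = "\<lambda>x. length (l x) * (poly u (vsize (enc x) + b x + vsize (enc (l x)) + 2) + 22)"
  show ?thesis
  proof (rule ptimeI[of "\<lambda>x. ?N x + R x + T x + 10"
        "PSeq (PFork L (PFork PId I)) (PSeq (PWhile PFst body) (PSeq PSnd PSnd))"])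
    show "\<exists>t\<le>?N x + R x + T x + 10.
        exec (PSeq (PFork L (PFork PId I)) (PSeq (PWhile PFst body) (PSeq PSnd PSnd)))
          (enc x) t (enc (foldl (g x) (i x) (l x)))" for x
    proof -
      from loop[of "l x" x "i x" "b x" "vsize (enc (l x))"] acc obtain t where
        t: "t \<le> ?N x + 2" "exec (PWhile PFst body) (VPair (enc (l x)) (VPair (enc x) (enc (i x)))) t
          (VPair VNil (VPair (enc x) (enc (foldl (g x) (i x) (l x)))))"
        using less_imp_le[OF vsize_mem[of _ "l x"]] by metis
      have "exec (PSeq PSnd PSnd) (VPair VNil (VPair (enc x) (enc (foldl (g x) (i x) (l x))))) 3
          (enc (foldl (g x) (i x) (l x)))"
        using exec_Seq[OF exec_Snd exec_Snd,
            of "VPair VNil (VPair (enc x) (enc (foldl (g x) (i x) (l x))))"]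
        by (simp add: numeral_3_eq_3)
      from exec_Seq[OF exec_Fork[OF l(1) exec_Fork[OF exec_Id i(1)]] exec_Seq[OF t(2) this]] t(1)
      show ?thesis by (intro exI[of _ "R x + (1 + T x + 1) + 1 + (t + 3 + 1) + 1"]) auto
    qed
    show "poly_bounded (\<lambda>x. vsize (enc (foldl (g x) (i x) (l x))))"
      using b by (rule poly_bounded_mono) (use acc[OF order_refl] in auto)
  qed (intro poly_bounded_intros l i b assms)
qed

lemma vsize_list: "vsize (enc xs) = 1 + (\<Sum>y\<leftarrow>xs. 1 + vsize (enc y))"
  by (induction xs) auto

lemma vsize_rev [simp]: "vsize (enc (rev xs)) = vsize (enc xs)"
  by (simp add: vsize_list rev_map[symmetric])

lemma vsize_append_le: "vsize (enc xs) \<le> vsize (enc (xs @ ys))" "vsize (enc ys) \<le> vsize (enc (xs @ ys))"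
  by (simp_all add: vsize_list)

lemma vsize_take_le: "vsize (enc (take k xs)) \<le> vsize (enc xs)"
  and vsize_drop_le: "vsize (enc (drop k xs)) \<le> vsize (enc xs)"
  using vsize_append_le[where xs = "take k xs" and ys = "drop k xs"] by simp_all

text \<open>Adapts a function of environment and element to the triples of environment, accumulator
  and element that \<open>ptime_foldl\<close> hands to its step.\<close>

lemma ptime_skip_middle:
  assumes "ptime (\<lambda>p. h (fst p) (snd p))"
  shows "ptime (\<lambda>p. h (fst p) (snd (snd p)))"
proof -
  have "ptime (\<lambda>p. (fst p, snd (snd p)))" by (intro ptime_intros)
  from ptime_compose[OF assms this] show ?thesis by simp
qed

lemma ptime_rev [ptime_intros]:
  assumes "ptime l" shows "ptime (\<lambda>x. rev (l x))"
proof -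
  have *: "foldl (\<lambda>a y. y # a) [] xs = rev xs" for xs :: "'b list"
    by (induction xs rule: rev_induct) auto
  have "ptime (\<lambda>x. foldl (\<lambda>a y. y # a) [] (l x))"
    by (rule ptime_foldl[where b = "\<lambda>x. vsize (enc (l x))"])
      (auto simp: * vsize_take_le intro!: ptime_intros poly_bounded_intros assms)
  then show ?thesis by (simp add: *)
qed

text \<open>A fold that conses the images produces them in reverse order, which
  \<open>ptime_rev\<close> repairs.\<close>

lemma ptime_map [ptime_intros]:
  assumes f: "ptime (\<lambda>p. f (fst p) (snd p))" and l: "ptime l"
  shows "ptime (\<lambda>x. map (f x) (l x))"
proof -
  have *: "foldl (\<lambda>a y. g y # a) [] xs = rev (map g xs)" for g :: "'b \<Rightarrow> 'c" and xs
    by (induction xs rule: rev_induct) auto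
  from poly_bounded_vsize_ptime[OF f] obtain q where
    q: "\<And>p. vsize (enc (f (fst p) (snd p))) \<le> poly q (vsize (enc p))"
    unfolding poly_bounded_def by blast
  let ?N = "\<lambda>x. poly q (1 + vsize (enc x) + vsize (enc (l x)))"
  have el: "vsize (enc (f x y)) \<le> ?N x" if "y \<in> set (l x)" for x y
    using q[of "(x, y)"] vsize_mem[OF that]
      poly_nat_mono[of "vsize (enc (x, y))" "1 + vsize (enc x) + vsize (enc (l x))" q] by simp
  have "ptime (\<lambda>x. foldl (\<lambda>a y. f x y # a) [] (l x))"
  proof (rule ptime_foldl[where b = "\<lambda>x. 1 + length (l x) * (1 + ?N x)"])
    fix x k assume k: "k \<le> length (l x)"
    have "vsize (enc (map (f x) (take k (l x)))) \<le> 1 + length (map (f x) (take k (l x))) * (1 + ?N x)"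
      by (intro vsize_list_le) (use el in_set_takeD in \<open>fastforce simp del: One_nat_def\<close>)
    also have "\<dots> \<le> 1 + length (l x) * (1 + ?N x)"
      by (intro add_left_mono mult_right_mono) auto
    finally show "vsize (enc (foldl (\<lambda>a y. f x y # a) [] (take k (l x)))) \<le> 1 + length (l x) * (1 + ?N x)"
      by (simp only: * vsize_rev)
  next
    show "ptime (\<lambda>p. f (fst p) (snd (snd p)) # fst (snd p))"
      by (intro ptime_intros ptime_skip_middle[OF f])
  qed (intro poly_bounded_intros ptime_intros l)+
  from ptime_rev[OF this] show ?thesis by (simp add: *)
qed

lemma ptime_filter [ptime_intros]:
  assumes P: "ptime (\<lambda>p. P (fst p) (snd p))" and l: "ptime l"
  shows "ptime (\<lambda>x. filter (P x) (l x))"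
proof -
  have *: "foldl (\<lambda>a y. if Q y then y # a else a) [] xs = rev (filter Q xs)" for Q :: "'b \<Rightarrow> bool" and xs
    by (induction xs rule: rev_induct) auto
  have "vsize (enc (filter Q xs)) \<le> vsize (enc xs)" for Q :: "'b \<Rightarrow> bool" and xs
    by (induction xs) auto
  then have "ptime (\<lambda>x. foldl (\<lambda>a y. if P x y then y # a else a) [] (l x))"
  proof (intro ptime_foldl[where b = "\<lambda>x. vsize (enc (l x))"])
    show "ptime (\<lambda>p. if P (fst p) (snd (snd p)) then snd (snd p) # fst (snd p) else fst (snd p))"
      by (intro ptime_intros ptime_skip_middle[OF P])
  qed (auto simp: * intro: le_trans[OF _ vsize_take_le] intro!: poly_bounded_intros ptime_intros l)
  from ptime_rev[OF this] show ?thesis by (simp add: *)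
qed

lemma ptime_list_ex [ptime_intros]:
  assumes P: "ptime (\<lambda>p. P (fst p) (snd p))" and l: "ptime l"
  shows "ptime (\<lambda>x. list_ex (P x) (l x))"
proof -
  have *: "foldl (\<lambda>a y. a \<or> Q y) False xs = list_ex Q xs" for Q :: "'b \<Rightarrow> bool" and xs
    by (induction xs rule: rev_induct) auto
  have "ptime (\<lambda>x. foldl (\<lambda>a y. a \<or> P x y) False (l x))"
  proof (rule ptime_foldl[where b = "\<lambda>x. 3"])
    show "ptime (\<lambda>p. fst (snd p) \<or> P (fst p) (snd (snd p)))"
      by (intro ptime_intros ptime_skip_middle[OF P])
  qed (auto intro!: poly_bounded_intros ptime_intros l vsize_vbool_le)
  then show ?thesis by (simp add: *)
qed

lemma ptime_length [ptime_intros]: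
  assumes l: "ptime l"
  shows "ptime (\<lambda>x. real (length (l x)))"
proof -
  have *: "foldl (\<lambda>a y. a + 1) 0 xs = real (length xs)" for xs :: "'b list"
    by (induction xs rule: rev_induct) auto
  have "ptime (\<lambda>x. foldl (\<lambda>a y. a + 1 :: real) 0 (l x))"
    by (rule ptime_foldl[where b = "\<lambda>x. 1"]) (auto intro!: poly_bounded_intros ptime_intros l)
  then show ?thesis by (simp add: *)
qed

lemma ptime_zip [ptime_intros]:
  assumes l: "ptime l" and m: "ptime m"
  shows "ptime (\<lambda>x. zip (l x) (m x))"
proof -
  \<comment> \<open>The fold runs over the first list and carries the rest of the second next to the
    pairs found; once that rest is empty the state no longer changes.\<close>
  define step where "step = (\<lambda>(s :: 'c list \<times> ('b \<times> 'c) list) y.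
    case fst s of [] \<Rightarrow> s | z # zs \<Rightarrow> (zs, (y, z) # snd s))"
  have *: "foldl step (ys, a) xs = (drop (length xs) ys, rev (zip xs ys) @ a)" for xs ys a
    by (induction xs arbitrary: ys a) (auto simp: step_def split: list.split)
  have el: "vsize (enc p) \<le> 1 + vsize (enc (l x)) + vsize (enc (m x))"
    if "p \<in> set (zip (take k (l x)) (m x))" for x p k
  proof -
    from that have "fst p \<in> set (l x)" "snd p \<in> set (m x)"
      by (metis in_set_takeD in_set_zipE prod.collapse)+
    from this[THEN vsize_mem] show ?thesis by (simp add: enc_prod_def)
  qed
  let ?N = "\<lambda>x. 2 + vsize (enc (l x)) + vsize (enc (m x))"
  have "ptime (\<lambda>x. foldl step (m x, []) (l x))"
  proof (rule ptime_foldl[where b = "\<lambda>x. 2 + vsize (enc (m x)) + length (l x) * ?N x"])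
    show "ptime (\<lambda>p. step (fst (snd p)) (snd (snd p)))"
      unfolding step_def by (intro ptime_intros)
    fix x k assume k: "k \<le> length (l x)"
    have "vsize (enc (zip (take k (l x)) (m x))) \<le> 1 + length (zip (take k (l x)) (m x)) * (1 + (1 + vsize (enc (l x)) + vsize (enc (m x))))"
      by (intro vsize_list_le el)
    also have "\<dots> \<le> 1 + length (l x) * (1 + (1 + vsize (enc (l x)) + vsize (enc (m x))))"
      by (intro add_left_mono mult_right_mono) auto
    finally show "vsize (enc (foldl step (m x, []) (take k (l x)))) \<le> 2 + vsize (enc (m x)) + length (l x) * ?N x"
      using vsize_drop_le[of k "m x"] k by (simp add: * min_absorb2)
  qed (intro poly_bounded_intros ptime_intros l m)+
  then have "ptime (\<lambda>x. rev (snd (foldl step (m x, []) (l x))))"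
    by (intro ptime_intros)
  then show ?thesis by (simp add: *)
qed

lemma ptime_real_eq [ptime_intros]:
  assumes "ptime f" "ptime g" shows "ptime (\<lambda>x. f x = (g x :: real))"
proof -
  have "ptime (\<lambda>x. f x \<le> g x \<and> g x \<le> f x)" by (intro ptime_intros assms)
  then show ?thesis by (simp add: order_eq_iff)
qed

section \<open>The reduction and the greedy algorithm as polynomial time functions\<close>

definition or_row :: "bool list \<Rightarrow> bool list \<Rightarrow> bool list" where
  "or_row r s = map (\<lambda>p. fst p \<or> snd p) (zip r s)"

text \<open>Row \<open>i\<close> of \<open>A\<close> marks the states with an edge into
  \<open>i\<close>, so row \<open>i\<close> absorbs the rows of its in-neighbours: this is the
  Boolean matrix \<open>R + A R\<close>.\<close>

definition propagate :: "bool list list \<Rightarrow> bool list list \<Rightarrow> bool list list" where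
  "propagate A R = map (\<lambda>p. foldl or_row (snd p) (map snd (filter fst (zip (fst p) R)))) (zip A R)"

text \<open>A relation on \<open>n\<close> states has at most \<open>n * n\<close> pairs, so that \<open>n * n\<close> rounds compute its closure.\<close>

definition reach_rows :: "bool list list \<Rightarrow> bool list list \<Rightarrow> bool list list" where
  "reach_rows A B = foldl (\<lambda>R _. foldl (\<lambda>R _. propagate A R) R A) B A"

definition row_le :: "bool list \<Rightarrow> bool list \<Rightarrow> bool" where
  "row_le r s \<longleftrightarrow> \<not> list_ex (\<lambda>p. fst p \<and> \<not> snd p) (zip r s)"

definition insert_minimal :: "bool list list \<Rightarrow> bool list \<Rightarrow> bool list list" where
  "insert_minimal M r = (if list_ex (\<lambda>s. row_le s r) M then M else r # filter (\<lambda>s. \<not> row_le r s) M)"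

definition minimal_rows :: "bool list list \<Rightarrow> bool list list" where
  "minimal_rows R = foldl insert_minimal [] R"

text \<open>Transposition; the length of \<open>c\<close> supplies the number of columns, which an
  empty \<open>R\<close> does not reveal.\<close>

definition columns :: "'a list \<Rightarrow> bool list list \<Rightarrow> bool list list" where
  "columns c R = foldl (\<lambda>T r. map (\<lambda>p. fst p # snd p) (zip r T)) (map (\<lambda>_. []) c) R"

text \<open>\<open>columns\<close> lists the entries of a column in reverse order, hence the \<open>rev\<close>.\<close>

definition reduction ::
  "bool list list \<times> bool list list \<times> real list \<Rightarrow> bool list list \<times> real list" where
  "reduction x = (columns (snd (snd x)) (rev (minimal_rows (reach_rows (fst x) (fst (snd x))))), snd (snd x))"

definition indices :: "'a list \<Rightarrow> real list" where
  "indices w = rev (foldl (\<lambda>a _. real (length a) # a) [] w)"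

type_synonym item = "real \<times> real \<times> bool list"

definition gain :: "bool list \<Rightarrow> item \<Rightarrow> real" where
  "gain V it = real (length (filter (\<lambda>p. fst p \<and> snd p) (zip (snd (snd it)) V)))"

text \<open>A list of at most one item stands for an optional item. Ratios of weight to gain are
  compared with denominators cleared, and items without gain are passed over.\<close>

definition better :: "bool list \<Rightarrow> item list \<Rightarrow> item \<Rightarrow> item list" where
  "better V b it = (if gain V it \<le> 0 then b else
     case b of [] \<Rightarrow> [it] | it' # _ \<Rightarrow>
       if fst (snd it') * gain V it \<le> fst (snd it) * gain V it' then b else [it])"

definition best :: "item list \<Rightarrow> bool list \<Rightarrow> item list" where
  "best items V = foldl (better V) [] items"

definition greedy_step :: "item list \<Rightarrow> bool list \<times> real list \<Rightarrow> bool list \<times> real list" where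
  "greedy_step items s = (case best items (fst s) of [] \<Rightarrow> s | it # _ \<Rightarrow>
     (map (\<lambda>p. fst p \<and> \<not> snd p) (zip (fst s) (snd (snd it))), fst it # snd s))"

text \<open>\<open>V\<close> is also the clock: as long as something coverable is left, a round
  covers at least one new element, so as many rounds as elements suffice.\<close>

definition greedy_loop :: "item list \<Rightarrow> bool list \<Rightarrow> bool list \<times> real list" where
  "greedy_loop items V = foldl (\<lambda>s _. greedy_step items s) (V, []) V"

text \<open>The universe is read off the first set, all sets of an encoded instance being rows of
  the same length.\<close>

definition greedy :: "bool list list \<times> real list \<Rightarrow> bool list" where
  "greedy x = map (\<lambda>i. list_ex (\<lambda>c. c = i)
       (snd (greedy_loop (zip (indices (snd x)) (zip (snd x) (fst x)))
          (case fst x of [] \<Rightarrow> [] | s # _ \<Rightarrow> map (\<lambda>_. True) s))))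
     (indices (snd x))"

section \<open>Size bounds for the intermediate data\<close>

lemma vsize_row_le: "vsize (enc (r :: bool list)) \<le> 1 + length r * 4"
  using vsize_list_le[of r 3] vsize_vbool_le by fastforce

text \<open>Dimensions are easier to carry through a loop than tree sizes; \<open>vsize_fits\<close>
  converts them at the end.\<close>

definition fits :: "nat \<Rightarrow> nat \<Rightarrow> 'a list list \<Rightarrow> bool" where
  "fits a b R \<longleftrightarrow> length R \<le> a \<and> (\<forall>r \<in> set R. length r \<le> b)"

lemma vsize_fits:
  assumes "fits a b (R :: bool list list)" shows "vsize (enc R) \<le> 1 + a * (2 + b * 4)"
proof -
  have "vsize (enc R) \<le> 1 + length R * (1 + (1 + b * 4))"
  proof (rule vsize_list_le)
    fix r assume "r \<in> set R"
    with assms have "length r \<le> b" by (simp add: fits_def)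
    with vsize_row_le[of r] show "vsize (enc r) \<le> 1 + b * 4" by linarith
  qed
  also have "\<dots> \<le> 1 + a * (1 + (1 + b * 4))"
    using assms by (intro add_left_mono mult_right_mono) (auto simp: fits_def)
  finally show ?thesis by simp
qed

lemma fits_vsize: "fits (vsize (enc R)) (vsize (enc R)) R"
proof -
  have "length r \<le> vsize (enc R)" if "r \<in> set R" for r
    using length_less_vsize[of r] vsize_mem[OF that] by simp
  then show ?thesis using length_less_vsize[of R] by (auto simp: fits_def)
qed

lemma ptime_or_row [ptime_intros]:
  "ptime f \<Longrightarrow> ptime g \<Longrightarrow> ptime (\<lambda>x. or_row (f x) (g x))"
  unfolding or_row_def by (intro ptime_intros)

lemma length_foldl_or_row: "length (foldl or_row r rs) \<le> length r"
proof (induction rs arbitrary: r)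
  case (Cons s rs)
  have "length (or_row r s) \<le> length r" by (simp add: or_row_def)
  with Cons[of "or_row r s"] show ?case by simp
qed simp

lemma ptime_foldl_or_row [ptime_intros]:
  assumes "ptime i" "ptime l"
  shows "ptime (\<lambda>x. foldl or_row (i x) (l x))"
proof (rule ptime_foldl[where b = "\<lambda>x. 1 + length (i x) * 4"])
  show "vsize (enc (foldl or_row (i x) (take k (l x)))) \<le> 1 + length (i x) * 4" for x k
    using vsize_row_le[of "foldl or_row (i x) (take k (l x))"]
      length_foldl_or_row[of "i x" "take k (l x)"] by linarith
qed (intro ptime_intros poly_bounded_intros assms)+

lemma ptime_propagate [ptime_intros]:
  assumes "ptime f" "ptime g" shows "ptime (\<lambda>x. propagate (f x) (g x))"
  unfolding propagate_def
  \<comment> \<open>The composed forms are for occurrences under a binder, where the environment has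
    become \<open>fst p\<close>.\<close>
  by (intro ptime_intros ptime_compose[OF assms(1)] ptime_compose[OF assms(2)] assms)

lemma fits_propagate:
  assumes "fits a b R" shows "fits a b (propagate A R)"
proof -
  have "length (foldl or_row s rs) \<le> b" if "(r, s) \<in> set (zip A R)" for r s rs
    using length_foldl_or_row[of s rs] set_zip_rightD[OF that] assms
    by (auto simp: fits_def intro: le_trans)
  then show ?thesis using assms by (auto simp: propagate_def fits_def)
qed

lemma fits_foldl_propagate: "fits a b R \<Longrightarrow> fits a b (foldl (\<lambda>R _. propagate A R) R l)"
  by (induction l arbitrary: R) (auto intro: fits_propagate)

lemma ptime_foldl_propagate [ptime_intros]:
  assumes "ptime A" "ptime R" "ptime l"
  shows "ptime (\<lambda>x. foldl (\<lambda>R _. propagate (A x) R) (R x) (l x))"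
  by (rule ptime_foldl[where b = "\<lambda>x. 1 + vsize (enc (R x)) * (2 + vsize (enc (R x)) * 4)"])
    (intro ptime_intros poly_bounded_intros ptime_compose[OF assms(1)] assms
      vsize_fits fits_foldl_propagate fits_vsize)+

lemma ptime_reach_rows [ptime_intros]:
  assumes "ptime A" "ptime B"
  shows "ptime (\<lambda>x. reach_rows (A x) (B x))"
  unfolding reach_rows_def
proof (rule ptime_foldl[where b = "\<lambda>x. 1 + vsize (enc (B x)) * (2 + vsize (enc (B x)) * 4)"])
  have *: "fits a b R \<Longrightarrow> fits a b (foldl (\<lambda>R _. foldl (\<lambda>R _. propagate A R) R A) R l)"
    for a b R A and l :: "'b list"
    by (induction l arbitrary: R) (auto intro: fits_foldl_propagate)
  show "vsize (enc (foldl (\<lambda>R _. foldl (\<lambda>R _. propagate (A x) R) R (A x)) (B x) (take k (A x))))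
      \<le> 1 + vsize (enc (B x)) * (2 + vsize (enc (B x)) * 4)" for x k
    by (intro vsize_fits * fits_vsize)
qed (intro ptime_intros poly_bounded_intros ptime_compose[OF assms(1)] assms)+

lemma ptime_row_le [ptime_intros]:
  "ptime f \<Longrightarrow> ptime g \<Longrightarrow> ptime (\<lambda>x. row_le (f x) (g x))"
  unfolding row_le_def by (intro ptime_intros)

lemma foldl_insert_minimal_fits:
  "set (foldl insert_minimal M R) \<subseteq> set M \<union> set R \<and>
   length (foldl insert_minimal M R) \<le> length M + length R"
proof (induction R arbitrary: M)
  case (Cons r R)
  have "set (insert_minimal M r) \<subseteq> insert r (set M)" "length (insert_minimal M r) \<le> Suc (length M)"
    by (auto simp: insert_minimal_def)
  with Cons[of "insert_minimal M r"] show ?case by auto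
qed auto

lemma ptime_minimal_rows [ptime_intros]:
  assumes "ptime R" shows "ptime (\<lambda>x. minimal_rows (R x))"
  unfolding minimal_rows_def
proof (rule ptime_foldl[where b = "\<lambda>x. 1 + vsize (enc (R x)) * (2 + vsize (enc (R x)) * 4)"])
  show "ptime (\<lambda>p. insert_minimal (fst (snd p)) (snd (snd p)))"
    unfolding insert_minimal_def by (intro ptime_intros)
  fix x k assume "k \<le> length (R x)"
  then have "fits (vsize (enc (R x))) (vsize (enc (R x))) (foldl insert_minimal [] (take k (R x)))"
    using foldl_insert_minimal_fits[of "[]" "take k (R x)"] fits_vsize[of "R x"]
    by (fastforce simp: fits_def dest: in_set_takeD)
  then show "vsize (enc (foldl insert_minimal [] (take k (R x))))
      \<le> 1 + vsize (enc (R x)) * (2 + vsize (enc (R x)) * 4)"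
    by (rule vsize_fits)
qed (intro ptime_intros poly_bounded_intros assms)+

lemma fits_columns: "fits (length c) (length R) (columns c R)"
proof -
  have "fits a b T \<Longrightarrow> fits a (b + length R)
      (foldl (\<lambda>T r. map (\<lambda>p. fst p # snd p) (zip r T)) T R)" for a b and T :: "bool list list"
  proof (induction R arbitrary: b T)
    case (Cons r R)
    then have "fits a (Suc b) (map (\<lambda>p. fst p # snd p) (zip r T))"
      by (auto simp: fits_def dest: set_zip_rightD)
    from Cons.IH[OF this] show ?case by simp
  qed auto
  from this[of "length c" 0 "map (\<lambda>_. []) c"] show ?thesis
    by (simp add: columns_def fits_def)
qed

lemma ptime_columns [ptime_intros]:
  assumes "ptime c" "ptime R" shows "ptime (\<lambda>x. columns (c x) (R x))"
  unfolding columns_def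
proof (rule ptime_foldl[where b = "\<lambda>x. 1 + length (c x) * (2 + length (R x) * 4)"])
  fix x k assume "k \<le> length (R x)"
  then have "fits (length (c x)) (length (R x)) (columns (c x) (take k (R x)))"
    using fits_columns[of "c x" "take k (R x)"] by (force simp: fits_def)
  from vsize_fits[OF this]
  show "vsize (enc (foldl (\<lambda>T r. map (\<lambda>p. fst p # snd p) (zip r T)) (map (\<lambda>_. []) (c x)) (take k (R x))))
      \<le> 1 + length (c x) * (2 + length (R x) * 4)" by (simp add: columns_def)
qed (intro ptime_intros poly_bounded_intros assms)+

lemma ptime_reduction: "ptime reduction"
  unfolding reduction_def by (intro ptime_intros)

lemma foldl_indices: "foldl (\<lambda>a _. real (length a) # a) [] w = rev (map real [0..<length w])"
  by (induction w rule: rev_induct) auto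

lemma ptime_indices [ptime_intros]:
  assumes "ptime w" shows "ptime (\<lambda>x. indices (w x))"
  unfolding indices_def
proof (rule ptime_rev, rule ptime_foldl[where b = "\<lambda>x. 1 + length (w x) * 2"])
  fix x k assume "k \<le> length (w x)"
  then show "vsize (enc (foldl (\<lambda>a _. real (length a) # a) [] (take k (w x)))) \<le> 1 + length (w x) * 2"
    using vsize_list_le[of "map real [0..<k]" 1] by (simp add: foldl_indices)
qed (intro ptime_intros poly_bounded_intros assms)+

lemma ptime_gain [ptime_intros]:
  "ptime V \<Longrightarrow> ptime f \<Longrightarrow> ptime (\<lambda>x. gain (V x) (f x))"
  unfolding gain_def by (intro ptime_intros)

lemma ptime_better [ptime_intros]:
  assumes "ptime V" "ptime f" "ptime g"
  shows "ptime (\<lambda>x. better (V x) (f x) (g x))"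
  unfolding better_def
  by (intro ptime_intros assms ptime_compose[OF assms(1)] ptime_compose[OF assms(2)] ptime_compose[OF assms(3)])

lemma foldl_better_fits:
  "(length b \<le> 1 \<longrightarrow> length (foldl (better V) b items) \<le> 1) \<and>
   set (foldl (better V) b items) \<subseteq> set b \<union> set items"
proof (induction items arbitrary: b)
  case (Cons it items)
  have *: "length (better V b it) \<le> 1" if "length b \<le> 1" for b using that
    by (auto simp: better_def split: list.split)
  have **: "set (better V b it) \<subseteq> insert it (set b)" for b
    by (auto simp: better_def split: list.split)
  show ?case using Cons[of "better V b it"] *[of b] **[of b] by auto
qed auto

lemma ptime_best [ptime_intros]:
  assumes "ptime items" "ptime V"
  shows "ptime (\<lambda>x. best (items x) (V x))"
  unfolding best_def
proof (rule ptime_foldl[where b = "\<lambda>x. 2 + vsize (enc (items x))"])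
  fix x k
  let ?b = "foldl (better (V x)) [] (take k (items x))"
  have "vsize (enc ?b) \<le> 1 + length ?b * (1 + vsize (enc (items x)))"
  proof (rule vsize_list_le)
    fix it assume "it \<in> set ?b"
    then have "it \<in> set (items x)"
      using foldl_better_fits[of "[]" "V x" "take k (items x)"] by (auto dest: in_set_takeD)
    then show "vsize (enc it) \<le> vsize (enc (items x))" using vsize_mem less_imp_le by blast
  qed
  also have "\<dots> \<le> 1 + 1 * (1 + vsize (enc (items x)))"
    using foldl_better_fits[of "[]" "V x" "take k (items x)"]
    by (intro add_left_mono mult_right_mono) auto
  finally show "vsize (enc ?b) \<le> 2 + vsize (enc (items x))" by simp
qed (intro ptime_intros poly_bounded_intros assms ptime_compose[OF assms(2)])+

lemma ptime_greedy_step [ptime_intros]: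
  assumes "ptime items" "ptime s"
  shows "ptime (\<lambda>x. greedy_step (items x) (s x))"
  unfolding greedy_step_def
  by (intro ptime_intros assms ptime_compose[OF assms(2)])

lemma foldl_greedy_step_fits:
  "length (fst (foldl (\<lambda>s _. greedy_step items s) s l)) \<le> length (fst s) \<and>
   length (snd (foldl (\<lambda>s _. greedy_step items s) s l)) \<le> length (snd s) + length l"
proof (induction l arbitrary: s)
  case (Cons y l)
  have "length (fst (greedy_step items s)) \<le> length (fst s)"
    "length (snd (greedy_step items s)) \<le> Suc (length (snd s))"
    by (auto simp: greedy_step_def split: list.split)
  with Cons[of "greedy_step items s"] show ?case by auto
qed auto

lemma ptime_greedy_loop [ptime_intros]:
  assumes "ptime items" "ptime V"
  shows "ptime (\<lambda>x. greedy_loop (items x) (V x))"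
  unfolding greedy_loop_def
\<comment> \<open>Per element of \<open>V\<close>: 4 for an entry of the uncovered row and 2 for a
  chosen index, since a round chooses at most one.\<close>
proof (rule ptime_foldl[where b = "\<lambda>x. 3 + length (V x) * 6"])
  fix x k assume "k \<le> length (V x)"
  let ?s = "foldl (\<lambda>s _. greedy_step (items x) s) (V x, []) (take k (V x))"
  have "length (fst ?s) \<le> length (V x)" "length (snd ?s) \<le> length (V x)"
    using foldl_greedy_step_fits[of "items x" "(V x, [])" "take k (V x)"] by simp_all
  then show "vsize (enc ?s) \<le> 3 + length (V x) * 6"
    using vsize_row_le[of "fst ?s"] vsize_list_le[of "snd ?s" 1] by (simp add: enc_prod_def)
qed (intro ptime_intros poly_bounded_intros assms ptime_compose[OF assms(1)])+

lemma ptime_greedy: "ptime greedy"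
  unfolding greedy_def by (intro ptime_intros)

section \<open>Approximation ratio of the greedy algorithm\<close>

definition true_set :: "bool list \<Rightarrow> nat set" where
  "true_set r = {k. k < length r \<and> r ! k}"

lemma finite_true_set [simp]: "finite (true_set r)"
  by (simp add: true_set_def)

lemma true_set_diff:
  "length r = length s \<Longrightarrow> true_set (map (\<lambda>p. fst p \<and> \<not> snd p) (zip r s)) = true_set r - true_set s"
  by (auto simp: true_set_def)

lemma gain_eq: "gain V it = real (card (true_set (snd (snd it)) \<inter> true_set V))"
proof -
  have "{i. i < length (zip (snd (snd it)) V) \<and> fst (zip (snd (snd it)) V ! i) \<and> snd (zip (snd (snd it)) V ! i)}
      = true_set (snd (snd it)) \<inter> true_set V"
    by (auto simp: true_set_def)
  then show ?thesis by (simp add: gain_def length_filter_conv_card)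
qed

definition is_best :: "bool list \<Rightarrow> item list \<Rightarrow> item \<Rightarrow> bool" where
  "is_best V items it \<longleftrightarrow> it \<in> set items \<and> 0 < gain V it \<and>
     (\<forall>it' \<in> set items. 0 < gain V it' \<longrightarrow> fst (snd it) * gain V it' \<le> fst (snd it') * gain V it)"

lemma best_correct:
  "case best items V of [] \<Rightarrow> \<forall>it \<in> set items. gain V it \<le> 0 | it # _ \<Rightarrow> is_best V items it"
  unfolding best_def
proof (induction items rule: rev_induct)
  case (snoc it items)
  show ?case
  proof (cases "foldl (better V) [] items")
    case Nil
    with snoc show ?thesis by (auto simp: better_def[of V "[]" it] is_best_def)
  next
    case (Cons b bs)
    then have b: "is_best V items b" using snoc by simp
    show ?thesis
    proof (cases "gain V it \<le> 0 \<or> fst (snd b) * gain V it \<le> fst (snd it) * gain V b")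
      case True
      with Cons b show ?thesis by (auto simp: better_def[of V "b # bs" it] is_best_def)
    next
      case False
      have "fst (snd it) * gain V it' \<le> fst (snd it') * gain V it"
        if it': "it' \<in> set items" "0 < gain V it'" for it'
      proof -
        have gb: "0 < gain V b" using b by (simp add: is_best_def)
        \<comment> \<open>Transitivity of the order by ratios along \<open>it\<close>,
          \<open>b\<close>, \<open>it'\<close>, with denominators cleared; the positive factor
          \<open>gain V b\<close> is cancelled at the end.\<close>
        have "(fst (snd it) * gain V it') * gain V b = (fst (snd it) * gain V b) * gain V it'" by simp
        also have "\<dots> \<le> (fst (snd b) * gain V it) * gain V it'"
          using False it' by (intro mult_right_mono) auto
        also have "\<dots> = (fst (snd b) * gain V it') * gain V it" by simp
        also have "\<dots> \<le> (fst (snd it') * gain V b) * gain V it"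
          using False it' b by (intro mult_right_mono) (auto simp: is_best_def)
        also have "\<dots> = (fst (snd it') * gain V it) * gain V b" by simp
        finally show ?thesis using gb by (rule mult_right_le_imp_le)
      qed
      with Cons False show ?thesis by (auto simp: better_def[of V "b # bs" it] is_best_def)
    qed
  qed
qed simp

section \<open>Harmonic numbers and the charging argument\<close>

definition harmonic :: "nat \<Rightarrow> real" where
  "harmonic n = (\<Sum>k = 1..n. 1 / real k)"

lemma harmonic_Suc: "harmonic (Suc n) = harmonic n + 1 / real (Suc n)"
  by (simp add: harmonic_def)

text \<open>The right-hand side sums \<open>1 / k\<close> over the \<open>a - b\<close> numbers
  \<open>k\<close> above \<open>b\<close> and up to \<open>a\<close>, and each term is at least
  \<open>1 / a\<close>.\<close>

lemma harmonic_diff_ge: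
  "b \<le> a \<Longrightarrow> (real a - real b) / real a \<le> harmonic a - harmonic b"
proof (induction rule: inc_induct)
  case (step b)
  have "1 / real a \<le> 1 / real (Suc b)" using step(2) by (intro divide_left_mono) auto
  with step(3) show ?case by (simp add: harmonic_Suc diff_divide_distrib add_divide_distrib)
qed simp

text \<open>The increment \<open>1 / (n + 1)\<close> is at most \<open>ln (n + 1) - ln n\<close>, by
  \<open>ln z \<le> z - 1\<close> at \<open>z = n / (n + 1)\<close>.\<close>

lemma harmonic_le_ln: "1 \<le> n \<Longrightarrow> harmonic n \<le> 1 + ln (real n)"
proof (induction n rule: dec_induct)
  case base
  then show ?case by (simp add: harmonic_def)
next
  case (step n)
  have "ln (real n / real (Suc n)) \<le> real n / real (Suc n) - 1"
    using step(1) by (intro ln_le_minus_one) auto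
  also have "\<dots> = - (1 / real (Suc n))" by (simp add: field_simps)
  finally have "1 / real (Suc n) \<le> ln (real (Suc n)) - ln (real n)"
    using step(1) by (simp add: ln_div)
  with step(3) show ?case by (simp add: harmonic_Suc)
qed

text \<open>The sum over a cover \<open>J\<close> of \<open>harmonic (card (c j \<inter> V)) * w j\<close> pays for the greedy choice:
  each \<open>j \<in> J\<close> contributes at least the greedy price of the elements that \<open>c j\<close> loses.\<close>

lemma greedy_potential:
  fixes c :: "'a \<Rightarrow> 'b set" and w :: "'a \<Rightarrow> real"
  assumes "finite J" "finite V" "V \<subseteq> (\<Union>j \<in> J. c j)" "\<And>j. j \<in> J \<Longrightarrow> 0 \<le> w j"
    and s: "0 \<le> w s" "0 < card (c s \<inter> V)"
    and min: "\<And>j. j \<in> J \<Longrightarrow> 0 < card (c j \<inter> V) \<Longrightarrow>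
      w s * real (card (c j \<inter> V)) \<le> w j * real (card (c s \<inter> V))"
  shows "w s + (\<Sum>j \<in> J. harmonic (card (c j \<inter> (V - c s))) * w j)
    \<le> (\<Sum>j \<in> J. harmonic (card (c j \<inter> V)) * w j)"
proof -
  let ?g = "real (card (c s \<inter> V))"
  let ?e = "\<lambda>j. card (c j \<inter> (c s \<inter> V))"
  \<comment> \<open>\<open>w s / ?g\<close> is the price of each newly covered element, and
    \<open>?e j\<close> of these lie in \<open>c j\<close>.\<close>
  have price: "w s / ?g * real (?e j)
      \<le> harmonic (card (c j \<inter> V)) * w j - harmonic (card (c j \<inter> (V - c s))) * w j" if "j \<in> J" for j
  proof (cases "card (c j \<inter> V) = 0")
    case True
    then have *: "c j \<inter> V = {}" using assms(2) by simp
    then have "c j \<inter> (c s \<inter> V) = {}" "c j \<inter> (V - c s) = {}" by auto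
    with * show ?thesis by simp
  next
    case False
    let ?a = "card (c j \<inter> V)" and ?b = "card (c j \<inter> (V - c s))"
    have "c j \<inter> V = (c j \<inter> (c s \<inter> V)) \<union> (c j \<inter> (V - c s))" by auto
    then have a: "?a = ?e j + ?b"
      using card_Un_disjoint[of "c j \<inter> (c s \<inter> V)" "c j \<inter> (V - c s)"] assms(2) by auto
    \<comment> \<open>The greedy choice: no \<open>j\<close> offers its uncovered elements at a
      lower price.\<close>
    have "w s / ?g \<le> w j / real ?a"
      using min[OF that] False s(2) by (simp add: field_simps)
    then have "w s / ?g * real (?e j) \<le> w j / real ?a * real (?e j)"
      by (rule mult_right_mono) simp
    also have "\<dots> = (real ?a - real ?b) / real ?a * w j" using a by simp
    also have "\<dots> \<le> (harmonic ?a - harmonic ?b) * w j"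
      using harmonic_diff_ge[of ?b ?a] a assms(4)[OF that] by (intro mult_right_mono) auto
    finally show ?thesis by (simp add: left_diff_distrib)
  qed
  \<comment> \<open>\<open>J\<close> covers \<open>V\<close>, so every element paid for lies in some
    \<open>c j\<close>; overlaps only enlarge the sum.\<close>
  have "card (c s \<inter> V) \<le> card (\<Union>j \<in> J. c j \<inter> (c s \<inter> V))"
    using assms(1-3) by (intro card_mono) auto
  also have "\<dots> \<le> (\<Sum>j \<in> J. ?e j)" using assms(1) by (rule card_UN_le)
  finally have "?g \<le> (\<Sum>j \<in> J. real (?e j))" by (simp flip: of_nat_sum)
  then have "w s / ?g * ?g \<le> w s / ?g * (\<Sum>j \<in> J. real (?e j))"
    using s by (intro mult_left_mono) auto
  also have "\<dots> \<le> (\<Sum>j \<in> J. harmonic (card (c j \<inter> V)) * w j - harmonic (card (c j \<inter> (V - c s))) * w j)"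
    unfolding sum_distrib_left by (intro sum_mono price)
  finally show ?thesis using s(2) by (simp add: sum_subtractf)
qed

lemma indices_eq: "indices w = map real [0..<length w]"
  by (simp add: indices_def foldl_indices)

section \<open>The greedy run and its invariant\<close>

locale cover_lists =
  fixes S :: "bool list list" and w :: "real list" and n m :: nat
  assumes len: "length S = m" "length w = m"
    and rows: "\<And>j. j < m \<Longrightarrow> length (S ! j) = n"
    and cover: "(\<Union>j < m. true_set (S ! j)) = {..<n}"
    and nonneg: "\<And>j. j < m \<Longrightarrow> 0 \<le> w ! j"
begin

abbreviation items :: "item list" where "items \<equiv> zip (indices w) (zip w S)"

lemma items_set: "set items = (\<lambda>j. (real j, w ! j, S ! j)) ` {..<m}"
  by (force simp: set_zip indices_eq len)

text \<open>\<open>I\<close> collects the indices chosen so far. The last clause bounds the cost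
  already paid plus the potential of the uncovered part; at the start all of it is potential, at the
  end all of it is cost. It ranges over every cover \<open>J\<close> because the run does not know
  an optimal one.\<close>

definition greedy_inv :: "bool list \<times> real list \<Rightarrow> nat set \<Rightarrow> bool" where
  "greedy_inv s I \<longleftrightarrow> length (fst s) = n \<and> I \<subseteq> {..<m} \<and> set (snd s) = real ` I \<and>
     true_set (fst s) = {..<n} - (\<Union>j \<in> I. true_set (S ! j)) \<and>
     (\<forall>J \<subseteq> {..<m}. (\<Union>j \<in> J. true_set (S ! j)) = {..<n} \<longrightarrow>
        (\<Sum>j \<in> I. w ! j) + (\<Sum>j \<in> J. harmonic (card (true_set (S ! j) \<inter> true_set (fst s))) * w ! j)
        \<le> (\<Sum>j \<in> J. harmonic (card (true_set (S ! j))) * w ! j))"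

lemma greedy_inv_step:
  assumes inv: "greedy_inv s I"
  obtains I' where "greedy_inv (greedy_step items s) I'"
    "card (true_set (fst (greedy_step items s))) \<le> card (true_set (fst s)) - 1"
proof (cases "best items (fst s)")
  case Nil
  let ?V = "true_set (fst s)"
  have "true_set (S ! j) \<inter> ?V = {}" if "j < m" for j
    using best_correct[of items "fst s"] that by (simp add: Nil items_set gain_eq)
  moreover have "?V \<subseteq> (\<Union>j < m. true_set (S ! j))"
    using inv unfolding cover greedy_inv_def by auto
  ultimately have "?V = {}" by blast
  \<comment> \<open>Nothing is left uncovered, and truncated subtraction turns the second claim into
    \<open>0 \<le> 0\<close>.\<close>
  with inv show thesis by (intro that[of I]) (simp_all add: greedy_step_def Nil)
next
  case (Cons it its)
  let ?V = "true_set (fst s)"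
  have "is_best (fst s) items it" using best_correct[of items "fst s"] by (simp add: Cons)
  then obtain i where i: "i < m" "it = (real i, w ! i, S ! i)" "0 < card (true_set (S ! i) \<inter> ?V)"
    and min: "\<And>j. j < m \<Longrightarrow> 0 < card (true_set (S ! j) \<inter> ?V) \<Longrightarrow>
      w ! i * real (card (true_set (S ! j) \<inter> ?V)) \<le> w ! j * real (card (true_set (S ! i) \<inter> ?V))"
    unfolding is_best_def items_set gain_eq by auto
  let ?s = "greedy_step items s"
  have V: "true_set (fst ?s) = ?V - true_set (S ! i)"
    using inv i by (simp add: greedy_step_def Cons true_set_diff rows greedy_inv_def)
  have fresh: "i \<notin> I"
  proof
    assume "i \<in> I"
    then have "true_set (S ! i) \<inter> ?V = {}" using inv by (auto simp: greedy_inv_def)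
    with i(3) show False by simp
  qed
  have finI: "finite I" using inv finite_subset[of I "{..<m}"] by (simp add: greedy_inv_def)
  show thesis
  proof (rule that[of "insert i I"])
    show "greedy_inv ?s (insert i I)"
      unfolding greedy_inv_def
    proof (intro conjI allI impI)
      show "length (fst ?s) = n" "insert i I \<subseteq> {..<m}" "set (snd ?s) = real ` insert i I"
        using inv i by (auto simp: greedy_step_def Cons rows greedy_inv_def)
      show "true_set (fst ?s) = {..<n} - (\<Union>j \<in> insert i I. true_set (S ! j))"
        using inv unfolding V greedy_inv_def by auto
      fix J assume J: "J \<subseteq> {..<m}" "(\<Union>j \<in> J. true_set (S ! j)) = {..<n}"
      have "w ! i + (\<Sum>j \<in> J. harmonic (card (true_set (S ! j) \<inter> (?V - true_set (S ! i)))) * w ! j)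
          \<le> (\<Sum>j \<in> J. harmonic (card (true_set (S ! j) \<inter> ?V)) * w ! j)"
      proof (rule greedy_potential)
        show "finite J" using J(1) finite_subset by blast
        show "?V \<subseteq> (\<Union>j \<in> J. true_set (S ! j))" using inv J(2) by (auto simp: greedy_inv_def)
      qed (use J(1) i min nonneg in auto)
      moreover have "(\<Sum>j \<in> I. w ! j) + (\<Sum>j \<in> J. harmonic (card (true_set (S ! j) \<inter> ?V)) * w ! j)
          \<le> (\<Sum>j \<in> J. harmonic (card (true_set (S ! j))) * w ! j)"
        using inv J unfolding greedy_inv_def by blast
      ultimately show "(\<Sum>j \<in> insert i I. w ! j)
          + (\<Sum>j \<in> J. harmonic (card (true_set (S ! j) \<inter> true_set (fst ?s))) * w ! j)
          \<le> (\<Sum>j \<in> J. harmonic (card (true_set (S ! j))) * w ! j)"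
        using fresh finI unfolding V by simp
    qed
    have "true_set (fst ?s) \<subset> ?V" unfolding V using i(3) by (auto simp: card_gt_0_iff)
    then have "card (true_set (fst ?s)) < card ?V" by (rule psubset_card_mono[rotated]) simp
    then show "card (true_set (fst ?s)) \<le> card ?V - 1" by simp
  qed
qed

lemma greedy_inv_foldl:
  assumes "greedy_inv s I"
  shows "\<exists>I'. greedy_inv (foldl (\<lambda>s _. greedy_step items s) s l) I' \<and>
    card (true_set (fst (foldl (\<lambda>s _. greedy_step items s) s l))) \<le> card (true_set (fst s)) - length l"
  using assms
proof (induction l arbitrary: s I)
  case (Cons y l)
  from greedy_inv_step[OF Cons.prems] obtain I' where
    "greedy_inv (greedy_step items s) I'"
    "card (true_set (fst (greedy_step items s))) \<le> card (true_set (fst s)) - 1" .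
  with Cons.IH[OF this(1)] show ?case by fastforce
qed auto

lemma greedy_correct:
  obtains I where "greedy (S, w) = map (\<lambda>j. j \<in> I) [0..<m]" "I \<subseteq> {..<m}"
    "(\<Union>j \<in> I. true_set (S ! j)) = {..<n}"
    "\<And>J. J \<subseteq> {..<m} \<Longrightarrow> (\<Union>j \<in> J. true_set (S ! j)) = {..<n} \<Longrightarrow>
       (\<Sum>j \<in> I. w ! j) \<le> (\<Sum>j \<in> J. harmonic (card (true_set (S ! j))) * w ! j)"
proof -
  let ?U = "case S of [] \<Rightarrow> [] | s # _ \<Rightarrow> map (\<lambda>_. True) s"
  \<comment> \<open>Without any sets \<open>cover\<close> forces \<open>n = 0\<close>, which agrees
    with the default \<open>[]\<close>.\<close>
  have lenU: "length ?U = n"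
    using rows[of 0] cover len(1) by (cases S) (auto simp: lessThan_empty_iff)
  moreover have "\<forall>k < length ?U. ?U ! k" by (cases S) auto
  ultimately have U: "true_set ?U = {..<n}" by (auto simp: true_set_def)
  have "true_set (S ! j) \<inter> {..<n} = true_set (S ! j)" if "j < m" for j
    using cover that by blast
  then have "greedy_inv (?U, []) {}"
    using lenU U by (auto simp: greedy_inv_def subset_iff intro!: sum_mono)
  from greedy_inv_foldl[OF this, of ?U] obtain I where
    I: "greedy_inv (greedy_loop items ?U) I" "card (true_set (fst (greedy_loop items ?U))) \<le> n - n"
    using lenU U by (auto simp: greedy_loop_def)
  then have V: "true_set (fst (greedy_loop items ?U)) = {}" by simp
  show thesis
  proof (rule that[of I])
    have "list_ex (\<lambda>c. c = real j) (snd (greedy_loop items ?U)) \<longleftrightarrow> j \<in> I" for j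
      using I(1) by (auto simp: greedy_inv_def list_ex_iff)
    then show "greedy (S, w) = map (\<lambda>j. j \<in> I) [0..<m]"
      by (simp add: greedy_def indices_eq len(2))
    show "I \<subseteq> {..<m}" using I(1) by (simp add: greedy_inv_def)
    then have "(\<Union>j \<in> I. true_set (S ! j)) \<subseteq> {..<n}" using cover by blast
    then show "(\<Union>j \<in> I. true_set (S ! j)) = {..<n}"
      using I(1) V by (auto simp: greedy_inv_def)
    show "(\<Sum>j \<in> I. w ! j) \<le> (\<Sum>j \<in> J. harmonic (card (true_set (S ! j))) * w ! j)"
      if "J \<subseteq> {..<m}" "(\<Union>j \<in> J. true_set (S ! j)) = {..<n}" for J
      using I(1) that V by (auto simp: greedy_inv_def harmonic_def)
  qed
qed

end

section \<open>Reduction of accessibility to set cover\<close>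

lemma foldl_or_row:
  assumes "length r = m" "\<And>s. s \<in> set rs \<Longrightarrow> length s = m"
  shows "length (foldl or_row r rs) = m \<and>
    (\<forall>j < m. foldl or_row r rs ! j \<longleftrightarrow> r ! j \<or> (\<exists>s \<in> set rs. s ! j))"
  using assms
proof (induction rs arbitrary: r)
  case (Cons s rs)
  have "length (or_row r s) = m" "\<forall>j < m. or_row r s ! j \<longleftrightarrow> r ! j \<or> s ! j"
    using Cons.prems by (simp_all add: or_row_def)
  with Cons.IH[of "or_row r s"] Cons.prems(2) show ?case by auto
qed simp

lemma propagate_nth:
  assumes "length A = n" "length R = n" "\<And>i. i < n \<Longrightarrow> length (A ! i) = n"
    "\<And>i. i < n \<Longrightarrow> length (R ! i) = m" "i < n"
  shows "length (propagate A R ! i) = m \<and>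
    (\<forall>j < m. propagate A R ! i ! j \<longleftrightarrow> R ! i ! j \<or> (\<exists>k < n. A ! i ! k \<and> R ! k ! j))"
proof -
  let ?rs = "map snd (filter fst (zip (A ! i) R))"
  have rs: "set ?rs = {R ! k | k. k < n \<and> A ! i ! k}"
    using assms(1-3,5) by (force simp: set_zip)
  have "propagate A R ! i = foldl or_row (R ! i) ?rs"
    using assms(1,2,5) by (simp add: propagate_def)
  moreover have "length (foldl or_row (R ! i) ?rs) = m \<and>
      (\<forall>j < m. foldl or_row (R ! i) ?rs ! j \<longleftrightarrow> R ! i ! j \<or> (\<exists>s \<in> {R ! k | k. k < n \<and> A ! i ! k}. s ! j))"
    using foldl_or_row[of "R ! i" m ?rs, unfolded rs] assms(4,5) by blast
  ultimately show ?thesis by auto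
qed

lemma length_propagate: "length (propagate A R) = min (length A) (length R)"
  by (simp add: propagate_def)

lemma foldl_const: "foldl (\<lambda>a _. f a) a l = (f ^^ length l) a"
  by (induction l arbitrary: a) (simp_all add: funpow_swap1)

lemma reach_rows_funpow: "reach_rows A B = (propagate A ^^ (length A * length A)) B"
  by (simp add: reach_rows_def foldl_const funpow_mult)

definition same_length :: "nat \<Rightarrow> bool list list \<Rightarrow> bool" where
  "same_length m R \<longleftrightarrow> (\<forall>r \<in> set R. length r = m)"

lemma row_le_iff: "length r = length s \<Longrightarrow> row_le r s \<longleftrightarrow> true_set r \<subseteq> true_set s"
  by (auto simp: row_le_def list_ex_iff set_zip true_set_def)

lemma true_set_inject: "length r = length s \<Longrightarrow> true_set r = true_set s \<Longrightarrow> r = s"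
  by (rule nth_equalityI) (auto simp: true_set_def)

text \<open>Distinctness is kept because the universe of the cover instance consists of positions in
  the list, which are later counted as rows.\<close>

definition minimal_inv :: "bool list list \<Rightarrow> bool list list \<Rightarrow> bool" where
  "minimal_inv P M \<longleftrightarrow> set M \<subseteq> set P \<and> distinct M \<and>
     (\<forall>r \<in> set P. \<exists>s \<in> set M. true_set s \<subseteq> true_set r) \<and>
     (\<forall>r \<in> set M. \<forall>s \<in> set M. true_set r \<subseteq> true_set s \<longrightarrow> r = s)"

lemma minimal_inv_insert:
  assumes "minimal_inv P M" "same_length m (P @ [r])"
  shows "minimal_inv (P @ [r]) (insert_minimal M r)"
proof -
  have le: "row_le s r \<longleftrightarrow> true_set s \<subseteq> true_set r" "row_le r s \<longleftrightarrow> true_set r \<subseteq> true_set s"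
    if "s \<in> set M" for s
    using that assms by (auto intro!: row_le_iff simp: minimal_inv_def same_length_def)
  show ?thesis
  proof (cases "\<exists>s \<in> set M. true_set s \<subseteq> true_set r")
    case True
    then have "insert_minimal M r = M" using le by (auto simp: insert_minimal_def list_ex_iff)
    with True assms(1) show ?thesis by (auto simp: minimal_inv_def)
  next
    case False
    then have M: "set (insert_minimal M r) = insert r {s \<in> set M. \<not> true_set r \<subseteq> true_set s}"
      "distinct (insert_minimal M r)"
      using le assms(1) by (auto simp: insert_minimal_def list_ex_iff minimal_inv_def)
    have "\<exists>s \<in> set (insert_minimal M r). true_set s \<subseteq> true_set q" if "q \<in> set (P @ [r])" for q
    proof (cases "q = r")
      case False
      with that assms(1) obtain s where "s \<in> set M" "true_set s \<subseteq> true_set q"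
        by (auto simp: minimal_inv_def)
      \<comment> \<open>If \<open>s\<close> was discarded for lying above \<open>r\<close>, then
        \<open>r\<close> takes its place below \<open>q\<close>.\<close>
      then show ?thesis unfolding M by (cases "true_set r \<subseteq> true_set s") auto
    qed (auto simp: M)
    with M False assms(1) show ?thesis by (auto simp: minimal_inv_def)
  qed
qed

lemma minimal_rows_inv:
  assumes "same_length m R" shows "minimal_inv R (minimal_rows R)"
  using assms
proof (induction R rule: rev_induct)
  case Nil
  then show ?case by (simp add: minimal_rows_def minimal_inv_def)
next
  case (snoc r R)
  then have "minimal_inv R (minimal_rows R)" by (simp add: same_length_def)
  from minimal_inv_insert[OF this snoc.prems] show ?case by (simp add: minimal_rows_def)
qed

lemma columns_eq:
  assumes "same_length (length c) R"
  shows "columns c R = map (\<lambda>j. map (\<lambda>r. r ! j) (rev R)) [0..<length c]"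
proof -
  have "foldl (\<lambda>T r. map (\<lambda>p. fst p # snd p) (zip r T)) (map (\<lambda>j. f j) [0..<m]) R
      = map (\<lambda>j. map (\<lambda>r. r ! j) (rev R) @ f j) [0..<m]" if "same_length m R" for f m
    using that
  proof (induction R arbitrary: f)
    case (Cons r R)
    then have "map (\<lambda>p. fst p # snd p) (zip r (map f [0..<m])) = map (\<lambda>j. r ! j # f j) [0..<m]"
      by (intro nth_equalityI) (auto simp: same_length_def)
    with Cons.IH[of "\<lambda>j. r ! j # f j"] Cons.prems show ?case by (simp add: same_length_def)
  qed simp
  from this[OF assms, of "\<lambda>_. []"] show ?thesis
    by (simp add: columns_def map_replicate_const)
qed

section \<open>Reachability of states from inputs\<close>

definition state_rel :: "struct_system \<Rightarrow> (nat \<times> nat) set" where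
  "state_rel \<Sigma> = {(k, i). k \<in> {1..n_states \<Sigma>} \<and> i \<in> {1..n_states \<Sigma>} \<and> A_mat \<Sigma> i k = Star}"

definition reached_by :: "struct_system \<Rightarrow> nat \<Rightarrow> nat \<Rightarrow> bool" where
  "reached_by \<Sigma> i j \<longleftrightarrow> (\<exists>s \<in> {1..n_states \<Sigma>}. B_mat \<Sigma> s j = Star \<and> (s, i) \<in> (state_rel \<Sigma>)\<^sup>*)"

definition A_rows :: "struct_system \<Rightarrow> bool list list" where
  "A_rows \<Sigma> = map (\<lambda>i. map (\<lambda>j. A_mat \<Sigma> i j = Star) [1..<Suc (n_states \<Sigma>)]) [1..<Suc (n_states \<Sigma>)]"

definition B_rows :: "struct_system \<Rightarrow> bool list list" where
  "B_rows \<Sigma> = map (\<lambda>i. map (\<lambda>j. B_mat \<Sigma> i j = Star) [1..<Suc (n_inputs \<Sigma>)]) [1..<Suc (n_states \<Sigma>)]"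

definition costs :: "struct_system \<Rightarrow> real list" where
  "costs \<Sigma> = map (input_cost \<Sigma>) [1..<Suc (n_inputs \<Sigma>)]"

lemma input_min_cost_accessibility:
  "input min_cost_accessibility \<Sigma> = enc (A_rows \<Sigma>, B_rows \<Sigma>, costs \<Sigma>)"
  by (simp add: min_cost_accessibility_def A_rows_def B_rows_def costs_def enc_list_def
      enc_bool_def enc_real_def comp_def del: upt_Suc)

text \<open>Each round extends the walks seen so far by one last edge. Lists count from 0 and
  structural matrices from 1, hence the \<open>Suc\<close>.\<close>

lemma propagate_funpow:
  "length ((propagate (A_rows \<Sigma>) ^^ t) (B_rows \<Sigma>)) = n_states \<Sigma> \<and>
   (\<forall>i < n_states \<Sigma>. length ((propagate (A_rows \<Sigma>) ^^ t) (B_rows \<Sigma>) ! i) = n_inputs \<Sigma> \<and>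
     (\<forall>j < n_inputs \<Sigma>. (propagate (A_rows \<Sigma>) ^^ t) (B_rows \<Sigma>) ! i ! j \<longleftrightarrow>
        (\<exists>s \<in> {1..n_states \<Sigma>}. B_mat \<Sigma> s (Suc j) = Star \<and> (\<exists>u \<le> t. (s, Suc i) \<in> state_rel \<Sigma> ^^ u))))"
proof (induction t)
  case 0
  show ?case by (auto simp: B_rows_def nth_append simp del: upt_Suc)
next
  case (Suc t)
  let ?n = "n_states \<Sigma>" and ?A = "A_rows \<Sigma>"
  let ?R = "(propagate ?A ^^ t) (B_rows \<Sigma>)"
  have A: "length ?A = ?n" "\<And>i. i < ?n \<Longrightarrow> length (?A ! i) = ?n"
    by (simp_all add: A_rows_def del: upt_Suc)
  have rel: "?A ! i ! k \<longleftrightarrow> (Suc k, Suc i) \<in> state_rel \<Sigma>" if "i < ?n" "k < ?n" for i k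
    using that by (simp add: A_rows_def state_rel_def del: upt_Suc)
  have nth: "length (propagate ?A ?R ! i) = n_inputs \<Sigma> \<and>
      (\<forall>j < n_inputs \<Sigma>. propagate ?A ?R ! i ! j \<longleftrightarrow> ?R ! i ! j \<or> (\<exists>k < ?n. ?A ! i ! k \<and> ?R ! k ! j))"
    if "i < ?n" for i
    using Suc that by (intro propagate_nth[OF A(1) _ A(2)]) auto
  have "propagate ?A ?R ! i ! j \<longleftrightarrow>
      (\<exists>s \<in> {1..?n}. B_mat \<Sigma> s (Suc j) = Star \<and> (\<exists>u \<le> Suc t. (s, Suc i) \<in> state_rel \<Sigma> ^^ u))"
    (is "_ \<longleftrightarrow> ?r") if ij: "i < ?n" "j < n_inputs \<Sigma>" for i j
  proof
    assume "propagate ?A ?R ! i ! j"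
    with nth ij consider "?R ! i ! j" | k where "k < ?n" "?A ! i ! k" "?R ! k ! j" by blast
    then show ?r
    proof cases
      case 1
      with Suc ij show ?thesis using le_Suc_eq by auto
    next
      case 2
      with Suc ij obtain s u where "s \<in> {1..?n}" "B_mat \<Sigma> s (Suc j) = Star" "u \<le> t"
        "(s, Suc k) \<in> state_rel \<Sigma> ^^ u" by blast
      moreover have "(Suc k, Suc i) \<in> state_rel \<Sigma>" using 2 ij rel by simp
      ultimately show ?thesis by (intro bexI[of _ s] conjI exI[of _ "Suc u"]) auto
    qed
  next
    assume ?r
    then obtain s u where s: "s \<in> {1..?n}" "B_mat \<Sigma> s (Suc j) = Star" "u \<le> Suc t"
      "(s, Suc i) \<in> state_rel \<Sigma> ^^ u" by blast
    show "propagate ?A ?R ! i ! j"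
    proof (cases "u \<le> t")
      case True
      with Suc s ij have "?R ! i ! j" by blast
      with nth ij show ?thesis by blast
    next
      case False
      with s(3) have "u = Suc t" by simp
      with s(4) obtain q where q: "(s, q) \<in> state_rel \<Sigma> ^^ t" "(q, Suc i) \<in> state_rel \<Sigma>" by auto
      then obtain k where k: "q = Suc k" "k < ?n"
        by (cases q) (auto simp: state_rel_def)
      with Suc s q(1) ij have "?R ! k ! j" by blast
      moreover have "?A ! i ! k" using rel k ij q(2) by simp
      ultimately show ?thesis using nth ij k(2) by blast
    qed
  qed
  moreover have "length (propagate ?A ?R) = ?n" using Suc A(1) by (simp add: length_propagate)
  ultimately show ?case using nth by simp
qed

lemma reach_rows_correct:
  defines "R \<equiv> \<lambda>\<Sigma>. reach_rows (A_rows \<Sigma>) (B_rows \<Sigma>)"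
  shows "length (R \<Sigma>) = n_states \<Sigma>" "same_length (n_inputs \<Sigma>) (R \<Sigma>)"
    "i < n_states \<Sigma> \<Longrightarrow> j < n_inputs \<Sigma> \<Longrightarrow> R \<Sigma> ! i ! j \<longleftrightarrow> reached_by \<Sigma> (Suc i) (Suc j)"
proof -
  let ?n = "n_states \<Sigma>"
  have "length (A_rows \<Sigma>) = ?n" by (simp add: A_rows_def del: upt_Suc)
  then have R: "R \<Sigma> = (propagate (A_rows \<Sigma>) ^^ (?n * ?n)) (B_rows \<Sigma>)"
    by (simp add: R_def reach_rows_funpow)
  show "length (R \<Sigma>) = n_states \<Sigma>" "same_length (n_inputs \<Sigma>) (R \<Sigma>)"
    using propagate_funpow[where \<Sigma> = \<Sigma> and t = "?n * ?n"] unfolding R same_length_def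
    by (simp, metis in_set_conv_nth)
  have fin: "state_rel \<Sigma> \<subseteq> {1..?n} \<times> {1..?n}" by (auto simp: state_rel_def)
  then have "card (state_rel \<Sigma>) \<le> ?n * ?n"
    using card_mono[OF _ fin] by simp
  \<comment> \<open>For a finite relation, powers up to its cardinality exhaust the reflexive
    transitive closure.\<close>
  then have "(s, Suc i) \<in> (state_rel \<Sigma>)\<^sup>* \<longleftrightarrow> (\<exists>u \<le> ?n * ?n. (s, Suc i) \<in> state_rel \<Sigma> ^^ u)" for s i
    using rtrancl_finite_eq_relpow[of "state_rel \<Sigma>"] finite_subset[OF fin]
    by (auto intro: relpow_imp_rtrancl) (use le_trans in blast)
  then show "R \<Sigma> ! i ! j \<longleftrightarrow> reached_by \<Sigma> (Suc i) (Suc j)" if "i < ?n" "j < n_inputs \<Sigma>"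
    using propagate_funpow[where \<Sigma> = \<Sigma> and t = "?n * ?n"] that unfolding R reached_by_def by simp
qed

lemma wf_state_digraph: "wf_digraph (with_proj (state_digraph \<Sigma>))"
  by unfold_locales (auto simp: state_digraph_def)

text \<open>The closure of \<open>state_rel \<Sigma>\<close> relates every number to itself, whereas
  \<open>reachable\<close> is confined to vertices; hence the range condition on
  \<open>k\<close>.\<close>

lemma state_reachable_iff:
  "reachable (with_proj (state_digraph \<Sigma>)) (X k) v \<longleftrightarrow>
     k \<in> {1..n_states \<Sigma>} \<and> (\<exists>i. v = X i \<and> (k, i) \<in> (state_rel \<Sigma>)\<^sup>*)"
proof -
  let ?G = "with_proj (state_digraph \<Sigma>)"
  interpret wf_digraph ?G by (rule wf_state_digraph)
  have "\<exists>i. v = X i \<and> (k, i) \<in> (state_rel \<Sigma>)\<^sup>*" if "(X k, v) \<in> (parcs (state_digraph \<Sigma>))\<^sup>*"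
    using that
  proof induction
    case (step u v)
    then show ?case
      by (auto simp: state_digraph_def state_rel_def intro!: rtrancl_into_rtrancl)
  qed auto
  moreover have "reachable ?G (X k) (X i)" if "(k, i) \<in> (state_rel \<Sigma>)\<^sup>*" "k \<in> {1..n_states \<Sigma>}" for i
    using that(1)
  proof induction
    case base
    from that(2) have "X k \<in> verts ?G" by (simp add: state_digraph_def)
    then show ?case by (rule reachable_refl)
  next
    case (step i l)
    from step(2) have "X i \<rightarrow>\<^bsub>?G\<^esub> X l" by (auto simp: state_digraph_def state_rel_def)
    with step(3) show ?case by (rule reachable_adj_trans)
  qed
  moreover have "k \<in> {1..n_states \<Sigma>}" if "reachable ?G (X k) v"
    using reachable_in_verts(1)[OF that] by (auto simp: state_digraph_def)
  ultimately show ?thesis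
    using reachable_rtranclI[of ?G "X k" v] by auto
qed

lemma wf_system_digraph: "wf_digraph (with_proj (system_digraph \<Sigma> I))"
  by unfold_locales (auto simp: system_digraph_def state_digraph_def)

text \<open>Feedback edges enter only inputs of \<open>I\<close>, which are themselves sources of walks, so that
  outputs and feedback do not matter.\<close>

lemma accessible_iff:
  assumes "i \<in> {1..n_states \<Sigma>}"
  shows "accessible \<Sigma> I i \<longleftrightarrow> (\<exists>j \<in> I. reached_by \<Sigma> i j)"
proof -
  let ?G = "with_proj (system_digraph \<Sigma> I)"
  interpret wf_digraph ?G by (rule wf_system_digraph)
  have walk: "\<forall>l. v = X l \<longrightarrow> (\<exists>j \<in> I. reached_by \<Sigma> l j)"
    if "reachable ?G (U j) v" "j \<in> I" for j v
    using that(1)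
  proof (induction rule: reachable_induct)
    case (step u v)
    show ?case
    proof (intro allI impI)
      fix l assume "v = X l"
      \<comment> \<open>An edge into a state starts at a state or at an input of \<open>I\<close>.
        In the second case that input is itself the witness, whatever walk led to it; this is where
        feedback is absorbed.\<close>
      with step(2) consider k where "u = X k" "(k, l) \<in> state_rel \<Sigma>"
        | j' where "j' \<in> I" "l \<in> {1..n_states \<Sigma>}" "B_mat \<Sigma> l j' = Star"
        by (auto simp: system_digraph_def state_digraph_def state_rel_def)
      then show "\<exists>j \<in> I. reached_by \<Sigma> l j"
      proof cases
        case 1
        with step(3) obtain j' where "j' \<in> I" "reached_by \<Sigma> k j'" by auto
        with 1(2) show ?thesis unfolding reached_by_def by (meson rtrancl_into_rtrancl)
      next
        case 2
        then show ?thesis unfolding reached_by_def by (intro bexI[of _ j'] bexI[of _ l]) auto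
      qed
    qed
  qed simp
  have "reachable ?G (U j) (X i)" if "j \<in> I" "s \<in> {1..n_states \<Sigma>}" "B_mat \<Sigma> s j = Star"
    "(s, i) \<in> (state_rel \<Sigma>)\<^sup>*" for j s
    using that(4)
  proof induction
    case base
    have "U j \<rightarrow>\<^bsub>?G\<^esub> X s" using that(1-3) by (auto simp: system_digraph_def)
    then show ?case by (rule reachable_adjI)
  next
    case (step k l)
    from step(2) have "X k \<rightarrow>\<^bsub>?G\<^esub> X l"
      by (auto simp: system_digraph_def state_digraph_def state_rel_def)
    with step(3) show ?case by (rule reachable_adj_trans)
  qed
  with walk show ?thesis
    \<comment> \<open>Simple paths reach the same vertices as walks.\<close>
    unfolding accessible_def reachable_apath[symmetric] reached_by_def by blast
qed

section \<open>The set cover instance of a system\<close>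

definition cover_rows :: "struct_system \<Rightarrow> bool list list" where
  "cover_rows \<Sigma> = minimal_rows (reach_rows (A_rows \<Sigma>) (B_rows \<Sigma>))"

definition cover_instance :: "struct_system \<Rightarrow> set_cover_instance" where
  "cover_instance \<Sigma> = \<lparr> universe_size = length (cover_rows \<Sigma>), num_sets = n_inputs \<Sigma>,
     the_set = (\<lambda>i. {k \<in> {1..length (cover_rows \<Sigma>)}. cover_rows \<Sigma> ! (k - 1) ! (i - 1)}),
     weight = input_cost \<Sigma> \<rparr>"

lemma cover_rows_inv:
  "minimal_inv (reach_rows (A_rows \<Sigma>) (B_rows \<Sigma>)) (cover_rows \<Sigma>)"
  "same_length (n_inputs \<Sigma>) (cover_rows \<Sigma>)"
proof -
  show inv: "minimal_inv (reach_rows (A_rows \<Sigma>) (B_rows \<Sigma>)) (cover_rows \<Sigma>)"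
    unfolding cover_rows_def using reach_rows_correct(2) by (rule minimal_rows_inv)
  then show "same_length (n_inputs \<Sigma>) (cover_rows \<Sigma>)"
    using reach_rows_correct(2)[of \<Sigma>] by (auto simp: minimal_inv_def same_length_def)
qed

text \<open>The tree computed by the reduction is literally the input of the cover instance, so a
  set cover program can be run on it directly.\<close>

lemma input_cover_instance:
  "input set_cover (cover_instance \<Sigma>) = enc (reduction (A_rows \<Sigma>, B_rows \<Sigma>, costs \<Sigma>))"
proof -
  have "columns (costs \<Sigma>) (rev (cover_rows \<Sigma>))
      = map (\<lambda>j. map (\<lambda>r. r ! j) (cover_rows \<Sigma>)) [0..<n_inputs \<Sigma>]"
    using columns_eq[of "costs \<Sigma>" "rev (cover_rows \<Sigma>)"] cover_rows_inv(2)[of \<Sigma>]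
    by (simp add: costs_def same_length_def del: upt_Suc)
  also have "\<dots> = map (\<lambda>i. map (\<lambda>k. k \<in> the_set (cover_instance \<Sigma>) i) [1..<Suc (length (cover_rows \<Sigma>))])
      [1..<Suc (n_inputs \<Sigma>)]"
    by (intro nth_equalityI) (auto simp: cover_instance_def intro!: nth_equalityI simp del: upt_Suc)
  finally show ?thesis
    by (simp add: reduction_def set_cover_def cover_rows_def[symmetric] enc_list_def enc_bool_def
        enc_real_def comp_def costs_def del: upt_Suc) (simp add: cover_instance_def del: upt_Suc)
qed

lemma true_set_subset_iff:
  assumes "same_length m R" "r \<in> set R" "s \<in> set R"
  shows "true_set r \<subseteq> true_set s \<longleftrightarrow> (\<forall>j < m. r ! j \<longrightarrow> s ! j)"
  using assms by (auto simp: true_set_def same_length_def)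

lemma ball_Suc_iff: "(\<forall>i \<in> {1..n}. P i) \<longleftrightarrow> (\<forall>i < n. P (Suc i))"
  unfolding image_Suc_lessThan[symmetric] by auto

text \<open>Whatever hits a minimal row hits every row above it. Members of \<open>I\<close> are at
  least 1, so \<open>j - 1\<close> is a genuine list position.\<close>

lemma cover_rows_hit_iff:
  assumes "I \<subseteq> {1..n_inputs \<Sigma>}"
  shows "(\<forall>r \<in> set (cover_rows \<Sigma>). \<exists>j \<in> I. r ! (j - 1)) \<longleftrightarrow>
    (\<forall>i \<in> {1..n_states \<Sigma>}. \<exists>j \<in> I. reached_by \<Sigma> i j)"
proof -
  let ?R = "reach_rows (A_rows \<Sigma>) (B_rows \<Sigma>)"
  note R = reach_rows_correct[where \<Sigma> = \<Sigma>]
  have inv: "set (cover_rows \<Sigma>) \<subseteq> set ?R"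
    "\<And>r. r \<in> set ?R \<Longrightarrow> \<exists>s \<in> set (cover_rows \<Sigma>). true_set s \<subseteq> true_set r"
    using cover_rows_inv(1)[of \<Sigma>] by (auto simp: minimal_inv_def)
  have "(\<forall>r \<in> set (cover_rows \<Sigma>). \<exists>j \<in> I. r ! (j - 1)) \<longleftrightarrow> (\<forall>r \<in> set ?R. \<exists>j \<in> I. r ! (j - 1))"
  proof
    assume cov: "\<forall>r \<in> set (cover_rows \<Sigma>). \<exists>j \<in> I. r ! (j - 1)"
    show "\<forall>r \<in> set ?R. \<exists>j \<in> I. r ! (j - 1)"
    proof
      fix r assume r: "r \<in> set ?R"
      with inv(2) obtain s where s: "s \<in> set (cover_rows \<Sigma>)" "true_set s \<subseteq> true_set r" by blast
      with cov obtain j where j: "j \<in> I" "s ! (j - 1)" by blast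
      moreover have "j - 1 < n_inputs \<Sigma>" using j(1) assms by fastforce
      ultimately show "\<exists>j \<in> I. r ! (j - 1)"
        using true_set_subset_iff[OF R(2), of s r] s inv(1) r by blast
    qed
  qed (use inv(1) in blast)
  also have "\<dots> \<longleftrightarrow> (\<forall>i < n_states \<Sigma>. \<exists>j \<in> I. ?R ! i ! (j - 1))"
    by (simp only: all_set_conv_all_nth R(1))
  also have "\<dots> \<longleftrightarrow> (\<forall>i < n_states \<Sigma>. \<exists>j \<in> I. reached_by \<Sigma> (Suc i) j)"
  proof (intro all_cong1 imp_cong refl bex_cong)
    fix i j assume "i < n_states \<Sigma>" "j \<in> I"
    then show "?R ! i ! (j - 1) = reached_by \<Sigma> (Suc i) j"
      using R(3)[of i "j - 1"] assms by (cases j) auto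
  qed
  also have "\<dots> \<longleftrightarrow> (\<forall>i \<in> {1..n_states \<Sigma>}. \<exists>j \<in> I. reached_by \<Sigma> i j)"
    by (simp only: ball_Suc_iff)
  finally show ?thesis .
qed

text \<open>Solutions carry over by the identity; as costs do too, the ratio survives the reduction
  without loss.\<close>

lemma cover_instance_feasible: "feasible set_cover (cover_instance \<Sigma>) = accessible_inputs \<Sigma>"
proof -
  have "(\<Union>i \<in> I. the_set (cover_instance \<Sigma>) i) = {1..universe_size (cover_instance \<Sigma>)}
      \<longleftrightarrow> (\<forall>r \<in> set (cover_rows \<Sigma>). \<exists>j \<in> I. r ! (j - 1))" (is "?l \<longleftrightarrow> ?r") for I
  proof -
    have "?l \<longleftrightarrow> (\<forall>k \<in> {1..length (cover_rows \<Sigma>)}. \<exists>j \<in> I. cover_rows \<Sigma> ! (k - 1) ! (j - 1))"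
      by (auto simp: cover_instance_def)
    also have "\<dots> \<longleftrightarrow> (\<forall>k < length (cover_rows \<Sigma>). \<exists>j \<in> I. cover_rows \<Sigma> ! k ! (j - 1))"
      by (simp only: ball_Suc_iff diff_Suc_1)
    finally show ?thesis by (simp only: all_set_conv_all_nth)
  qed
  then have "I \<in> feasible set_cover (cover_instance \<Sigma>) \<longleftrightarrow>
      I \<subseteq> {1..n_inputs \<Sigma>} \<and> (\<forall>r \<in> set (cover_rows \<Sigma>). \<exists>j \<in> I. r ! (j - 1))" for I
    by (simp add: set_cover_def) (simp add: cover_instance_def)
  then have "I \<in> feasible set_cover (cover_instance \<Sigma>) \<longleftrightarrow>
      I \<subseteq> {1..n_inputs \<Sigma>} \<and> (\<forall>i \<in> {1..n_states \<Sigma>}. accessible \<Sigma> I i)" for I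
    using cover_rows_hit_iff[of I \<Sigma>] by (simp add: accessible_iff cong: conj_cong)
  then show ?thesis unfolding accessible_inputs_def by (intro set_eqI) simp
qed

lemma cover_instance_instance:
  assumes "\<Sigma> \<in> instances min_cost_accessibility"
  shows "cover_instance \<Sigma> \<in> instances set_cover"
proof -
  from assms have \<Sigma>: "1 \<le> n_states \<Sigma>" "\<forall>j \<in> {1..n_inputs \<Sigma>}. 0 \<le> input_cost \<Sigma> j"
    "{1..n_inputs \<Sigma>} \<in> feasible set_cover (cover_instance \<Sigma>)"
    by (simp_all add: min_cost_accessibility_def cover_instance_feasible)
  \<comment> \<open>The universe must be nonempty: the row of the first state lies above some
    minimal row.\<close>
  have "reach_rows (A_rows \<Sigma>) (B_rows \<Sigma>) ! 0 \<in> set (reach_rows (A_rows \<Sigma>) (B_rows \<Sigma>))"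
    using \<Sigma>(1) reach_rows_correct(1)[of \<Sigma>] by (intro nth_mem) simp
  then have "cover_rows \<Sigma> \<noteq> []"
    using cover_rows_inv(1)[of \<Sigma>] by (auto simp: minimal_inv_def)
  with \<Sigma> show ?thesis
    by (auto simp: set_cover_def cover_instance_def Suc_le_eq)
qed

section \<open>Minimal rows and non-top linked components\<close>

text \<open>An ancestor of \<open>i\<close> with the fewest ancestors lies in a non-top linked component.\<close>

lemma exists_non_top_linked_ancestor:
  assumes "i \<in> {1..n_states \<Sigma>}"
  obtains s where "s \<in> {1..n_states \<Sigma>}" "(s, i) \<in> (state_rel \<Sigma>)\<^sup>*"
    "\<And>k. (k, s) \<in> (state_rel \<Sigma>)\<^sup>* \<Longrightarrow> (s, k) \<in> (state_rel \<Sigma>)\<^sup>*"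
proof -
  let ?anc = "\<lambda>i. {k. (k, i) \<in> (state_rel \<Sigma>)\<^sup>*}"
  have range: "k \<in> {1..n_states \<Sigma>}" if "(k, l) \<in> (state_rel \<Sigma>)\<^sup>*" "l \<in> {1..n_states \<Sigma>}" for k l
    using that by (induction rule: converse_rtrancl_induct) (auto simp: state_rel_def)
  obtain s where s: "s \<in> ?anc i" "\<And>k. k \<in> ?anc i \<Longrightarrow> card (?anc s) \<le> card (?anc k)"
    using ex_has_least_nat[of "\<lambda>k. k \<in> ?anc i" i "\<lambda>k. card (?anc k)"] by auto
  have s_range: "s \<in> {1..n_states \<Sigma>}" using range s(1) assms by auto
  then have "?anc s \<subseteq> {1..n_states \<Sigma>}" using range by blast
  then have fin: "finite (?anc s)" by (rule finite_subset) simp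
  show thesis
  proof (rule that[OF s_range])
    show "(s, i) \<in> (state_rel \<Sigma>)\<^sup>*" using s(1) by simp
    fix k assume k: "(k, s) \<in> (state_rel \<Sigma>)\<^sup>*"
    then have "?anc k \<subseteq> ?anc s" by (auto intro: rtrancl_trans)
    moreover have "card (?anc s) \<le> card (?anc k)" using k s(1) by (intro s(2)) (auto intro: rtrancl_trans)
    ultimately have "?anc k = ?anc s" using fin by (intro card_seteq) auto
    then show "(s, k) \<in> (state_rel \<Sigma>)\<^sup>*" by blast
  qed
qed

text \<open>Every input that reaches an ancestor of a state reaches the state, so passing to an
  ancestor can only shrink the row, and minimality of \<open>r\<close> excludes a proper
  shrinking.\<close>

lemma cover_row_component:
  assumes "r \<in> set (cover_rows \<Sigma>)"
  obtains s where "s \<in> {1..n_states \<Sigma>}" "r = reach_rows (A_rows \<Sigma>) (B_rows \<Sigma>) ! (s - 1)"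
    "\<And>k. (k, s) \<in> (state_rel \<Sigma>)\<^sup>* \<Longrightarrow> (s, k) \<in> (state_rel \<Sigma>)\<^sup>*"
proof -
  let ?R = "reach_rows (A_rows \<Sigma>) (B_rows \<Sigma>)"
  note R = reach_rows_correct[where \<Sigma> = \<Sigma>]
  from assms have "r \<in> set ?R" using cover_rows_inv(1)[of \<Sigma>] by (auto simp: minimal_inv_def)
  then obtain i where i: "i < n_states \<Sigma>" "r = ?R ! i" using R(1) by (auto simp: in_set_conv_nth)
  then have "Suc i \<in> {1..n_states \<Sigma>}" by simp
  then obtain s where s: "s \<in> {1..n_states \<Sigma>}" "(s, Suc i) \<in> (state_rel \<Sigma>)\<^sup>*"
    "\<And>k. (k, s) \<in> (state_rel \<Sigma>)\<^sup>* \<Longrightarrow> (s, k) \<in> (state_rel \<Sigma>)\<^sup>*"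
    by (rule exists_non_top_linked_ancestor) blast
  then obtain q where q: "s = Suc q" "q < n_states \<Sigma>" by (cases s) auto
  have mem: "?R ! q \<in> set ?R" using q(2) R(1) by simp
  have "true_set (?R ! q) \<subseteq> true_set r"
    using true_set_subset_iff[OF R(2) mem \<open>r \<in> set ?R\<close>] R(3) q i s(2)
    by (auto simp: reached_by_def intro: rtrancl_trans)
  moreover obtain r' where r': "r' \<in> set (cover_rows \<Sigma>)" "true_set r' \<subseteq> true_set (?R ! q)"
    using cover_rows_inv(1)[of \<Sigma>] mem by (auto simp: minimal_inv_def)
  ultimately have "r' = r" using assms cover_rows_inv(1)[of \<Sigma>] by (auto simp: minimal_inv_def)
  with r' \<open>true_set (?R ! q) \<subseteq> true_set r\<close> have "true_set r = true_set (?R ! q)" by auto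
  then have "r = ?R ! q"
    using mem \<open>r \<in> set ?R\<close> R(2) by (intro true_set_inject) (simp_all add: same_length_def)
  with s q show thesis by (intro that[of s]) auto
qed

definition component :: "struct_system \<Rightarrow> nat \<Rightarrow> vertex set" where
  "component \<Sigma> s = X ` {k. (s, k) \<in> (state_rel \<Sigma>)\<^sup>* \<and> (k, s) \<in> (state_rel \<Sigma>)\<^sup>*}"

lemma component_non_top_linked:
  assumes s: "s \<in> {1..n_states \<Sigma>}" "\<And>k. (k, s) \<in> (state_rel \<Sigma>)\<^sup>* \<Longrightarrow> (s, k) \<in> (state_rel \<Sigma>)\<^sup>*"
  shows "non_top_linked \<Sigma> (component \<Sigma> s)"
proof -
  let ?G = "with_proj (state_digraph \<Sigma>)"
  interpret wf_digraph ?G by (rule wf_state_digraph)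
  have comp: "component \<Sigma> s = scc_of (X s)"
    \<comment> \<open>A number that reaches \<open>s\<close> is \<open>s\<close> itself or the
      source of an edge, hence within the range of the states.\<close>
    unfolding scc_of_def component_def using s(1)
    by (auto simp: state_reachable_iff) (auto simp: state_rel_def elim: converse_rtranclE)
  have "X s \<in> verts ?G" using s(1) by (simp add: state_digraph_def)
  then have scc: "component \<Sigma> s \<in> state_sccs \<Sigma>"
    unfolding state_sccs_def comp by (rule scc_of_in_sccs_verts)
  moreover have "T = component \<Sigma> s" if T: "T \<in> state_sccs \<Sigma>" "u \<in> T" "v \<in> component \<Sigma> s"
    "(u, v) \<in> parcs (state_digraph \<Sigma>)" for T u v
  proof -
    from T(4) obtain k l where u: "u = X k" "v = X l" "(k, l) \<in> state_rel \<Sigma>"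
      by (auto simp: state_digraph_def state_rel_def)
    with T(3) have "(k, s) \<in> (state_rel \<Sigma>)\<^sup>*"
      by (auto simp: component_def intro: converse_rtrancl_into_rtrancl)
    \<comment> \<open>\<open>u\<close> reaches \<open>s\<close>, so the hypothesis on
      \<open>s\<close> puts it into the component; as distinct components are disjoint,
      \<open>T\<close> is this one.\<close>
    with s(2) have "u \<in> component \<Sigma> s" by (auto simp: component_def u)
    with sccs_verts_disjoint[of T "component \<Sigma> s"] T(1,2) scc show ?thesis
      by (auto simp: state_sccs_def)
  qed
  ultimately show ?thesis unfolding non_top_linked_def by blast
qed

lemma finite_state_sccs: "finite (state_sccs \<Sigma>)"
proof -
  interpret wf_digraph "with_proj (state_digraph \<Sigma>)" by (rule wf_state_digraph)
  have "state_sccs \<Sigma> \<subseteq> Pow (X ` {1..n_states \<Sigma>})"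
    using sccs_verts_subsets by (auto simp: state_sccs_def state_digraph_def)
  then show ?thesis by (rule finite_subset) simp
qed

text \<open>Each element of the set of \<open>j\<close> stands for a minimal row and is sent
  injectively to a non-top linked component that \<open>j\<close> itself covers.\<close>

lemma card_the_set_le:
  assumes j: "j \<in> {1..n_inputs \<Sigma>}"
  shows "card (the_set (cover_instance \<Sigma>) j) \<le> mu_max \<Sigma>"
proof -
  let ?R = "reach_rows (A_rows \<Sigma>) (B_rows \<Sigma>)" and ?M = "cover_rows \<Sigma>"
  let ?C = "{S. non_top_linked \<Sigma> S \<and> covered_by \<Sigma> S j}"
  have "\<exists>s. s \<in> {1..n_states \<Sigma>} \<and> r = ?R ! (s - 1) \<and>
      (\<forall>k. (k, s) \<in> (state_rel \<Sigma>)\<^sup>* \<longrightarrow> (s, k) \<in> (state_rel \<Sigma>)\<^sup>*)" if "r \<in> set ?M" for r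
    by (rule cover_row_component[OF that]) blast
  then obtain f where f: "\<And>r. r \<in> set ?M \<Longrightarrow> f r \<in> {1..n_states \<Sigma>}"
    "\<And>r. r \<in> set ?M \<Longrightarrow> r = ?R ! (f r - 1)"
    "\<And>r k. r \<in> set ?M \<Longrightarrow> (k, f r) \<in> (state_rel \<Sigma>)\<^sup>* \<Longrightarrow> (f r, k) \<in> (state_rel \<Sigma>)\<^sup>*"
    by metis
  have hit: "r ! (l - 1) \<longleftrightarrow> reached_by \<Sigma> (f r) l" if "r \<in> set ?M" "l \<in> {1..n_inputs \<Sigma>}" for r l
    using reach_rows_correct(3)[where i = "f r - 1" and \<Sigma> = \<Sigma> and j = "l - 1"] f(1,2)[OF that(1)] that(2) by auto
  have inj: "inj_on (\<lambda>r. component \<Sigma> (f r)) (set ?M)"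
  proof (rule inj_onI)
    fix r s assume rs: "r \<in> set ?M" "s \<in> set ?M" "component \<Sigma> (f r) = component \<Sigma> (f s)"
    then have "X (f r) \<in> component \<Sigma> (f s)" by (auto simp: component_def)
    then have *: "(f r, f s) \<in> (state_rel \<Sigma>)\<^sup>*" "(f s, f r) \<in> (state_rel \<Sigma>)\<^sup>*"
      by (auto simp: component_def)
    have "reached_by \<Sigma> (f r) l \<longleftrightarrow> reached_by \<Sigma> (f s) l" for l
      unfolding reached_by_def using * by (meson rtrancl_trans)
    then have "r ! (l - 1) \<longleftrightarrow> s ! (l - 1)" if "l \<in> {1..n_inputs \<Sigma>}" for l
      using hit rs that by simp
    then have "r ! l \<longleftrightarrow> s ! l" if "l < n_inputs \<Sigma>" for l using that
      by (metis Suc_leI atLeastAtMost_iff diff_Suc_1 le_add1 plus_1_eq_Suc)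
    with cover_rows_inv(2)[of \<Sigma>] rs show "r = s"
      by (intro nth_equalityI) (auto simp: same_length_def)
  qed
  let ?K = "{r \<in> set ?M. r ! (j - 1)}"
  \<comment> \<open>A path into a non-top linked component starts inside it. So the state through
    which \<open>j\<close> enters belongs to the component, and \<open>j\<close> covers it rather
    than merely reaching it.\<close>
  have "component \<Sigma> (f r) \<in> ?C" if "r \<in> ?K" for r
  proof -
    from that j hit obtain s where s: "s \<in> {1..n_states \<Sigma>}" "B_mat \<Sigma> s j = Star"
      "(s, f r) \<in> (state_rel \<Sigma>)\<^sup>*" by (auto simp: reached_by_def)
    with f(3) that have "X s \<in> component \<Sigma> (f r)" by (auto simp: component_def)
    with s component_non_top_linked f that show ?thesis by (auto simp: covered_by_def)
  qed
  moreover have fin: "finite ?C"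
    by (rule finite_subset[OF _ finite_state_sccs[of \<Sigma>]]) (auto simp: non_top_linked_def)
  ultimately have "card ?K \<le> card ?C"
    using inj by (intro card_inj_on_le[of "\<lambda>r. component \<Sigma> (f r)"]) (auto elim: inj_on_subset)
  also have "\<dots> \<le> mu_max \<Sigma>" unfolding mu_max_def using j by (intro Max_ge) auto
  finally have "card ?K \<le> mu_max \<Sigma>" .
  moreover have "card (the_set (cover_instance \<Sigma>) j) \<le> card ?K"
  proof (rule card_inj_on_le[of "\<lambda>k. ?M ! (k - 1)"])
    have "distinct ?M" using cover_rows_inv(1)[of \<Sigma>] by (simp add: minimal_inv_def)
    then show "inj_on (\<lambda>k. ?M ! (k - 1)) (the_set (cover_instance \<Sigma>) j)"
      by (intro inj_onI) (auto simp: cover_instance_def nth_eq_iff_index_eq)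
  qed (auto simp: cover_instance_def)
  ultimately show ?thesis by simp
qed

section \<open>Transfer of approximation algorithms\<close>

lemma finite_feasible_set_cover: "finite (feasible set_cover x)"
  by (rule finite_subset[of _ "Pow {1..num_sets x}"]) (auto simp: set_cover_def)

lemma set_cover_optimum_attained:
  assumes "x \<in> instances set_cover"
  obtains I where "I \<in> feasible set_cover x" "optimum set_cover x = (\<Sum>i \<in> I. weight x i)"
proof -
  have "{1..num_sets x} \<in> feasible set_cover x"
    using assms by (auto simp: set_cover_def)
  then have "optimum set_cover x \<in> cost set_cover x ` feasible set_cover x"
    unfolding optimum_def using finite_feasible_set_cover by (intro Min_in) auto
  with that show thesis by (auto simp: set_cover_def)
qed

lemma set_cover_optimum_nonneg:
  assumes "x \<in> instances set_cover" shows "0 \<le> optimum set_cover x"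
proof -
  from assms obtain I where I: "I \<in> feasible set_cover x" "optimum set_cover x = (\<Sum>i \<in> I. weight x i)"
    by (rule set_cover_optimum_attained)
  have "0 \<le> (\<Sum>i \<in> I. weight x i)"
    using assms I(1) by (intro sum_nonneg) (auto simp: set_cover_def)
  with I(2) show ?thesis by simp
qed

section \<open>The greedy ratio on encoded set cover instances\<close>

definition max_set_size :: "set_cover_instance \<Rightarrow> nat" where
  "max_set_size x = Max ((\<lambda>i. card (the_set x i)) ` {1..num_sets x})"

definition set_rows :: "set_cover_instance \<Rightarrow> bool list list" where
  "set_rows x = map (\<lambda>i. map (\<lambda>k. k \<in> the_set x i) [1..<Suc (universe_size x)]) [1..<Suc (num_sets x)]"

definition weights :: "set_cover_instance \<Rightarrow> real list" where
  "weights x = map (weight x) [1..<Suc (num_sets x)]"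

lemma input_set_cover: "input set_cover x = enc (set_rows x, weights x)"
  by (simp add: set_cover_def set_rows_def weights_def enc_list_def enc_bool_def enc_real_def
      comp_def del: upt_Suc)

text \<open>Lists count from 0 and set cover instances from 1; \<open>Suc\<close> translates
  elements and set indices alike.\<close>

lemma image_Suc_true_set_rows:
  assumes "x \<in> instances set_cover" "j < num_sets x"
  shows "Suc ` true_set (set_rows x ! j) = the_set x (Suc j)"
proof -
  have "true_set (set_rows x ! j) = {k. k < universe_size x \<and> Suc k \<in> the_set x (Suc j)}"
    using assms(2) by (auto simp: set_rows_def true_set_def simp del: upt_Suc)
  moreover have "the_set x (Suc j) \<subseteq> Suc ` {..<universe_size x}"
    using assms by (auto simp: set_cover_def image_Suc_lessThan)
  ultimately show ?thesis by auto
qed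

lemma set_rows_cover_iff:
  assumes "x \<in> instances set_cover" "I \<subseteq> {..<num_sets x}"
  shows "(\<Union>j \<in> I. true_set (set_rows x ! j)) = {..<universe_size x} \<longleftrightarrow>
    Suc ` I \<in> feasible set_cover x"
proof -
  have "(\<Union>j \<in> I. true_set (set_rows x ! j)) = {..<universe_size x} \<longleftrightarrow>
      Suc ` (\<Union>j \<in> I. true_set (set_rows x ! j)) = Suc ` {..<universe_size x}"
    by (simp only: inj_image_eq_iff inj_Suc)
  also have "\<dots> \<longleftrightarrow> (\<Union>j \<in> I. the_set x (Suc j)) = {1..universe_size x}"
  proof -
    have "Suc ` (\<Union>j \<in> I. true_set (set_rows x ! j)) = (\<Union>j \<in> I. the_set x (Suc j))"
      unfolding image_UN using assms by (intro SUP_cong refl image_Suc_true_set_rows) auto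
    then show ?thesis by (simp only: image_Suc_lessThan)
  qed
  also have "\<dots> \<longleftrightarrow> Suc ` I \<in> feasible set_cover x"
    using assms(2) by (auto simp: set_cover_def)
  finally show ?thesis .
qed

lemma sum_weights: "I \<subseteq> {..<num_sets x} \<Longrightarrow> (\<Sum>j \<in> I. weights x ! j) = (\<Sum>i \<in> Suc ` I. weight x i)"
  by (simp add: sum.reindex, intro sum.cong) (auto simp: weights_def simp del: upt_Suc)

text \<open>Zero is included because \<open>ln 0 = 0\<close>; this lets the harmonic bound apply to
  empty sets.\<close>

lemma ln_real_mono: "a \<le> b \<Longrightarrow> ln (real a) \<le> ln (real b)"
  by (cases "a = 0"; cases "b = 0") auto

lemma harmonic_le_ln': "n \<le> d \<Longrightarrow> harmonic n \<le> 1 + ln (real d)"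
proof (cases "n = 0")
  case True
  then show ?thesis using ln_real_mono[of 0 d] by (simp add: harmonic_def)
next
  case False
  assume "n \<le> d"
  from harmonic_le_ln[of n] ln_real_mono[OF this] False show ?thesis by linarith
qed

lemma greedy_set_cover:
  assumes x: "x \<in> instances set_cover"
  shows "\<exists>I. enc (greedy (set_rows x, weights x)) = enc_subset (num_sets x) I \<and>
    eps_optimal set_cover x (1 + ln (real (max_set_size x))) I"
proof -
  interpret cover_lists "set_rows x" "weights x" "universe_size x" "num_sets x"
  proof
    have "Suc ` {..<num_sets x} \<in> feasible set_cover x"
      using x by (auto simp: set_cover_def image_Suc_lessThan)
    then show "(\<Union>j < num_sets x. true_set (set_rows x ! j)) = {..<universe_size x}"
      using set_rows_cover_iff[OF x order_refl] by simp
  qed (use x in \<open>auto simp: set_rows_def weights_def set_cover_def simp del: upt_Suc\<close>)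
  obtain I where I: "greedy (set_rows x, weights x) = map (\<lambda>j. j \<in> I) [0..<num_sets x]"
    "I \<subseteq> {..<num_sets x}" "(\<Union>j \<in> I. true_set (set_rows x ! j)) = {..<universe_size x}"
    "\<And>J. J \<subseteq> {..<num_sets x} \<Longrightarrow> (\<Union>j \<in> J. true_set (set_rows x ! j)) = {..<universe_size x} \<Longrightarrow>
       (\<Sum>j \<in> I. weights x ! j) \<le> (\<Sum>j \<in> J. harmonic (card (true_set (set_rows x ! j))) * weights x ! j)"
    using greedy_correct by blast
  obtain J' where J': "J' \<in> feasible set_cover x" "optimum set_cover x = (\<Sum>i \<in> J'. weight x i)"
    using set_cover_optimum_attained[OF x] .
  have "J' \<subseteq> Suc ` {..<num_sets x}" using J'(1) by (simp add: set_cover_def image_Suc_lessThan)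
  then obtain J where J: "J \<subseteq> {..<num_sets x}" "J' = Suc ` J" by (rule subset_imageE)
  then have "(\<Union>j \<in> J. true_set (set_rows x ! j)) = {..<universe_size x}"
    using set_rows_cover_iff[OF x J(1)] J'(1) by simp
  from I(4)[OF J(1) this]
  have "(\<Sum>i \<in> Suc ` I. weight x i) \<le> (\<Sum>j \<in> J. harmonic (card (true_set (set_rows x ! j))) * weights x ! j)"
    by (simp only: sum_weights[OF I(2)])
  also have "\<dots> \<le> (\<Sum>j \<in> J. (1 + ln (real (max_set_size x))) * weights x ! j)"
  proof (intro sum_mono mult_right_mono harmonic_le_ln')
    fix j assume "j \<in> J"
    then have j: "j < num_sets x" using J(1) by auto
    then show "0 \<le> weights x ! j" by (rule nonneg)
    have "card (true_set (set_rows x ! j)) = card (the_set x (Suc j))"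
      unfolding image_Suc_true_set_rows[OF x j, symmetric] by (simp add: card_image)
    also have "\<dots> \<le> max_set_size x" unfolding max_set_size_def using j by (intro Max_ge) auto
    finally show "card (true_set (set_rows x ! j)) \<le> max_set_size x" .
  qed
  also have "\<dots> = (1 + ln (real (max_set_size x))) * optimum set_cover x"
    by (simp only: J'(2) J(2) sum_weights[OF J(1)] flip: sum_distrib_left)
  finally have "eps_optimal set_cover x (1 + ln (real (max_set_size x))) (Suc ` I)"
    using I(3) set_rows_cover_iff[OF x I(2)] by (simp add: eps_optimal_def) (simp add: set_cover_def)
  moreover have "map (\<lambda>j. j \<in> I) [0..<num_sets x] = map (\<lambda>i. i \<in> Suc ` I) [1..<Suc (num_sets x)]"
    by (intro nth_equalityI) (auto simp del: upt_Suc)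
  then have "enc (greedy (set_rows x, weights x)) = enc_subset (num_sets x) (Suc ` I)"
    unfolding I(1) by (simp add: enc_subset_def enc_list_def enc_bool_def comp_def del: upt_Suc)
  ultimately show ?thesis by blast
qed

section \<open>From polynomial time functions to approximation algorithms\<close>

lemma ptime_polynomial_time:
  assumes "ptime f" and "\<And>x. x \<in> instances \<P> \<Longrightarrow> \<exists>y. input \<P> x = enc y \<and>
    (\<exists>I. enc (f y) = enc_subset (num_items \<P> x) I \<and> eps_optimal \<P> x (\<epsilon> x) I)"
  shows "\<exists>P. polynomial_time \<P> P \<and> eps_optimal_algorithm \<P> \<epsilon> P"
proof -
  from assms(1) obtain P q where P: "\<And>y. \<exists>t. exec P (enc y) t (enc (f y))
     \<and> t + vsize (enc (f y)) \<le> poly q (vsize (enc y))"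
    unfolding ptime_def by auto
  have run: "\<exists>t I. exec P (input \<P> x) t (enc_subset (num_items \<P> x) I) \<and> eps_optimal \<P> x (\<epsilon> x) I
      \<and> t \<le> poly q (vsize (input \<P> x))" if x: "x \<in> instances \<P>" for x
  proof -
    from assms(2)[OF x] obtain y I where y: "input \<P> x = enc y"
      "enc (f y) = enc_subset (num_items \<P> x) I" "eps_optimal \<P> x (\<epsilon> x) I" by blast
    from P[of y] obtain t where "exec P (enc y) t (enc (f y))"
      "t + vsize (enc (f y)) \<le> poly q (vsize (enc y))" by blast
    with y show ?thesis by (intro exI[of _ t] exI[of _ I]) simp
  qed
  have "polynomial_time \<P> P"
    unfolding polynomial_time_def using run by blast
  moreover have "eps_optimal_algorithm \<P> \<epsilon> P"
    unfolding eps_optimal_algorithm_def using run by blast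
  ultimately show ?thesis by blast
qed

lemma set_cover_greedy_algorithm:
  "\<exists>P. polynomial_time set_cover P \<and>
     eps_optimal_algorithm set_cover (\<lambda>x. 1 + ln (real (max_set_size x))) P"
proof (rule ptime_polynomial_time[OF ptime_greedy])
  fix x assume "x \<in> instances set_cover"
  from greedy_set_cover[OF this]
  show "\<exists>y. input set_cover x = enc y \<and> (\<exists>I. enc (greedy y) = enc_subset (num_items set_cover x) I \<and>
      eps_optimal set_cover x (1 + ln (real (max_set_size x))) I)"
    by (intro exI[of _ "(set_rows x, weights x)"]) (simp only: input_set_cover, simp add: set_cover_def)
qed

lemma cost_cover_instance:
  "cost set_cover (cover_instance \<Sigma>) = cost min_cost_accessibility \<Sigma>"
  by (simp add: set_cover_def min_cost_accessibility_def cover_instance_def)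

lemma optimum_cover_instance:
  "optimum set_cover (cover_instance \<Sigma>) = optimum min_cost_accessibility \<Sigma>"
  by (simp add: optimum_def cost_cover_instance cover_instance_feasible)
    (simp add: min_cost_accessibility_def)

text \<open>The ratio is a function of the instance so that both claims follow: a constant gives the
  first, the size of the largest set leads to the second.\<close>

lemma reduction_transfers:
  assumes "polynomial_time set_cover P" "eps_optimal_algorithm set_cover \<rho> P"
  shows "\<exists>Q. polynomial_time min_cost_accessibility Q
    \<and> eps_optimal_algorithm min_cost_accessibility (\<lambda>\<Sigma>. \<rho> (cover_instance \<Sigma>)) Q"
proof -
  from ptime_reduction obtain R r where R: "\<And>y. \<exists>t. exec R (enc y) t (enc (reduction y))
     \<and> t + vsize (enc (reduction y)) \<le> poly r (vsize (enc y))"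
    unfolding ptime_def by blast
  from assms(1) obtain q where q: "\<And>x. x \<in> instances set_cover \<Longrightarrow>
      \<exists>t w. exec P (input set_cover x) t w \<and> t \<le> poly q (vsize (input set_cover x))"
    unfolding polynomial_time_def by auto
  have run: "\<exists>t I. exec (PSeq R P) (input min_cost_accessibility \<Sigma>) t
        (enc_subset (num_items min_cost_accessibility \<Sigma>) I)
      \<and> eps_optimal min_cost_accessibility \<Sigma> (\<rho> (cover_instance \<Sigma>)) I
      \<and> t \<le> poly (r + pcompose q r + [:1:]) (vsize (input min_cost_accessibility \<Sigma>))"
    if \<Sigma>: "\<Sigma> \<in> instances min_cost_accessibility" for \<Sigma>
  proof -
    let ?x = "cover_instance \<Sigma>" and ?v = "input min_cost_accessibility \<Sigma>"
    note x = cover_instance_instance[OF \<Sigma>]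
    from assms(2) x obtain t I where t: "exec P (input set_cover ?x) t (enc_subset (num_items set_cover ?x) I)"
      and I: "eps_optimal set_cover ?x (\<rho> ?x) I"
      unfolding eps_optimal_algorithm_def by blast
    \<comment> \<open>The time bound and the ratio each assert some run of \<open>P\<close>;
      determinism makes these the same run.\<close>
    from q[OF x] exec_det[OF t] have t_le: "t \<le> poly q (vsize (input set_cover ?x))" by blast
    obtain s where s: "exec R ?v s (input set_cover ?x)" "s + vsize (input set_cover ?x) \<le> poly r (vsize ?v)"
      using R[of "(A_rows \<Sigma>, B_rows \<Sigma>, costs \<Sigma>)"]
      unfolding input_min_cost_accessibility input_cover_instance by blast
    \<comment> \<open>\<open>P\<close> is charged by the size of the constructed instance, which the
      polynomial of the reduction bounds along with its time.\<close>
    have "poly q (vsize (input set_cover ?x)) \<le> poly q (poly r (vsize ?v))"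
      using s(2) by (intro poly_nat_mono) simp
    with t_le s(2) have "s + t + 1 \<le> poly (r + pcompose q r + [:1:]) (vsize ?v)"
      by (simp add: poly_pcompose)
    moreover have "num_items set_cover ?x = num_items min_cost_accessibility \<Sigma>"
      by (simp add: set_cover_def min_cost_accessibility_def cover_instance_def)
    moreover have "eps_optimal min_cost_accessibility \<Sigma> (\<rho> ?x) I"
      using I by (simp add: eps_optimal_def optimum_cover_instance cost_cover_instance cover_instance_feasible)
        (simp add: min_cost_accessibility_def)
    ultimately show ?thesis using exec_Seq[OF s(1) t]
      by (intro exI[of _ "s + t + 1"] exI[of _ I]) simp
  qed
  have "polynomial_time min_cost_accessibility (PSeq R P)"
    unfolding polynomial_time_def using run by blast
  moreover have "eps_optimal_algorithm min_cost_accessibility (\<lambda>\<Sigma>. \<rho> (cover_instance \<Sigma>)) (PSeq R P)"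
    unfolding eps_optimal_algorithm_def using run by blast
  ultimately show ?thesis by blast
qed

lemma max_set_size_cover_instance:
  assumes "\<Sigma> \<in> instances min_cost_accessibility"
  shows "max_set_size (cover_instance \<Sigma>) \<le> mu_max \<Sigma>"
proof -
  have "num_sets (cover_instance \<Sigma>) \<noteq> 0"
    using cover_instance_instance[OF assms] by (auto simp: set_cover_def)
  then show ?thesis
    unfolding max_set_size_def using card_the_set_le[of _ \<Sigma>]
    by (intro Max.boundedI) (auto simp: cover_instance_def)
qed

text \<open>The ratio multiplies the optimum, so enlarging it relaxes the bound when the optimum is
  nonnegative.\<close>

lemma eps_optimal_algorithm_mono:
  assumes "eps_optimal_algorithm \<P> \<rho> P"
    and "\<And>x. x \<in> instances \<P> \<Longrightarrow> \<rho> x \<le> \<sigma> x" "\<And>x. x \<in> instances \<P> \<Longrightarrow> 0 \<le> optimum \<P> x"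
  shows "eps_optimal_algorithm \<P> \<sigma> P"
  unfolding eps_optimal_algorithm_def
proof
  fix x assume x: "x \<in> instances \<P>"
  with assms(1) obtain t I where "exec P (input \<P> x) t (enc_subset (num_items \<P> x) I)"
    and I: "eps_optimal \<P> x (\<rho> x) I"
    unfolding eps_optimal_algorithm_def by blast
  moreover have "\<rho> x * optimum \<P> x \<le> \<sigma> x * optimum \<P> x"
    using assms(2,3)[OF x] by (rule mult_right_mono)
  with I have "eps_optimal \<P> x (\<sigma> x) I" unfolding eps_optimal_def by linarith
  ultimately show "\<exists>t I. exec P (input \<P> x) t (enc_subset (num_items \<P> x) I) \<and> eps_optimal \<P> x (\<sigma> x) I"
    by blast
qed

theorem theorem2:
  shows "(\<forall>\<epsilon> :: real.
           (\<exists>P. polynomial_time set_cover P \<and> eps_optimal_algorithm set_cover (\<lambda>_. \<epsilon>) P) \<longrightarrow>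
           (\<exists>Q. polynomial_time min_cost_accessibility Q
              \<and> eps_optimal_algorithm min_cost_accessibility (\<lambda>_. \<epsilon>) Q))
       \<and> (\<exists>Q. polynomial_time min_cost_accessibility Q
              \<and> eps_optimal_algorithm min_cost_accessibility
                  (\<lambda>\<Sigma>. 1 + ln (real (mu_max \<Sigma>))) Q)"
proof (intro conjI allI impI)
  fix \<epsilon> :: real
  assume "\<exists>P. polynomial_time set_cover P \<and> eps_optimal_algorithm set_cover (\<lambda>_. \<epsilon>) P"
  then show "\<exists>Q. polynomial_time min_cost_accessibility Q
      \<and> eps_optimal_algorithm min_cost_accessibility (\<lambda>_. \<epsilon>) Q"
    using reduction_transfers[where \<rho> = "\<lambda>_. \<epsilon>"] by blast
next
  obtain P where "polynomial_time set_cover P"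
    "eps_optimal_algorithm set_cover (\<lambda>x. 1 + ln (real (max_set_size x))) P"
    using set_cover_greedy_algorithm by blast
  from reduction_transfers[OF this] obtain Q where "polynomial_time min_cost_accessibility Q"
    "eps_optimal_algorithm min_cost_accessibility
      (\<lambda>\<Sigma>. 1 + ln (real (max_set_size (cover_instance \<Sigma>)))) Q"
    by blast
  moreover from this(2)
  have "eps_optimal_algorithm min_cost_accessibility (\<lambda>\<Sigma>. 1 + ln (real (mu_max \<Sigma>))) Q"
  proof (rule eps_optimal_algorithm_mono)
    fix \<Sigma> assume \<Sigma>: "\<Sigma> \<in> instances min_cost_accessibility"
    show "1 + ln (real (max_set_size (cover_instance \<Sigma>))) \<le> 1 + ln (real (mu_max \<Sigma>))"
      using max_set_size_cover_instance[OF \<Sigma>] by (simp add: ln_real_mono)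
    show "0 \<le> optimum min_cost_accessibility \<Sigma>"
      using set_cover_optimum_nonneg[OF cover_instance_instance[OF \<Sigma>]]
      by (simp add: optimum_cover_instance)
  qed
  ultimately show "\<exists>Q. polynomial_time min_cost_accessibility Q
      \<and> eps_optimal_algorithm min_cost_accessibility (\<lambda>\<Sigma>. 1 + ln (real (mu_max \<Sigma>))) Q"
    by blast
qed

end
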